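(* Let $1\le\gamma<\infty$, let $\varphi\in\mathcal{L}(\gamma)$ be univalent, let $\theta\in[0,\pi)$, and let $F^\theta_{\alpha\beta}=H+\overline{G}$ be a sense-preserving harmonic mapping in $\mathbb{D}$ which is the horizontal shear of $C^\theta_{\alpha\beta}[\varphi]$ with dilatation $w_{\alpha\beta}=\alpha(1+\beta)w$. Then the following hold. (i) For $\beta\ge1$, $F^\theta_{\alpha\beta}\in\mathcal{S}_{\mathbb{H}}$ for all non-negative $\alpha$ satisfying $$\alpha\le\frac{1}{2\gamma+2\beta+(1+\beta)\|w^*\|(1+\|w\|)}.\qquad( * )$$ (ii) For $0\le\beta<1$: (a) if $\beta+2(1+\beta)\|w^*\|(1+\|w\|)\le 2(1-\beta)$, then $F^\theta_{\alpha\beta}\in\mathcal{S}_{\mathbb{H}}$ for all non-negative $\alpha$ satisfying $$\alpha\le\frac{4(1-\beta)}{4(2\gamma+1)(1-\beta)+\big(\beta+(1+\beta)\|w^*\|(1+\|w\|)\big)^2+4(1-\beta^2)\|w^*\|};$$ (b) if $\beta+2(1+\beta)\|w^*\|(1+\|w\|)>2(1-\beta)$, then $F^\theta_{\alpha\beta}\in\mathcal{S}_{\mathbb{H}}$ for all non-negative $\alpha$ satisfying inequality $( * )$.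
   Context: $\mathbb{D}=\{z\in\mathbb{C}:|z|<1\}$. A family $\mathcal{L}$ of analytic locally univalent functions $\varphi$ in $\mathbb{D}$ normalized by $\varphi(0)=0$, $\varphi'(0)=1$ is a linear invariant family if for every $\varphi\in\mathcal{L}$ and every automorphism $\varphi_a(z)=(z+a)/(1+\overline{a}z)$, $a\in\mathbb{D}$, the function $\frac{(\varphi\circ\varphi_a)(z)-\varphi(a)}{(1-|a|^2)\varphi'(a)}$ belongs to $\mathcal{L}$. Its order is $\gamma=\sup\{|a_2(\varphi)|:\varphi\in\mathcal{L}\}$, where $a_2(\varphi)$ is the second Taylor coefficient of $\varphi$ at $0$. $\mathcal{L}(\gamma)$ denotes a linear invariant family of order $\gamma$, $\gamma\ge1$. Define $$C_{\alpha\beta}[\varphi](z)=\int_0^z\Big(\frac{\varphi(\zeta)}{\zeta(1-\zeta)^{\beta}}\Big)^{\alpha}\,d\zeta,\qquad C^\theta_{\alpha\beta}[\varphi](z)=e^{-i\theta}C_{\alpha\beta}[\varphi](e^{i\theta}z),\qquad z\in\mathbb{D},$$ with the analytic branches of the powers for which the integrand equals $1$ at $\zeta=0$. Let $w$ be an analytic function in $\mathbb{D}$ with $|w(z)|<1$, and $w_{\alpha\beta}(z)=\alpha(1+\beta)w(z)$. The horizontal shear of $C^\theta_{\alpha\beta}[\varphi]$ with dilatation $w_{\alpha\beta}$ is the harmonic mapping $F^\theta_{\alpha\beta}=H+\overline{G}$, with $H,G$ analytic in $\mathbb{D}$, $H-G=C^\theta_{\alpha\beta}[\varphi]$, $G'=w_{\alpha\beta}H'$,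 and normalization $H(0)=G(0)=0$, $H'(0)=1$, $G'(0)=0$. It is sense-preserving if $|H'|^2-|G'|^2>0$ (equivalently $|w_{\alpha\beta}|<1$) in $\mathbb{D}$. $\|w\|=\sup_{z\in\mathbb{D}}|w(z)|$ and $\|w^*\|=\sup_{z\in\mathbb{D}}\frac{|w'(z)|(1-|z|^2)}{1-|w(z)|^2}$ (the hyperbolic norm of $w$). $\mathcal{S}_{\mathbb{H}}$ is the class of univalent harmonic mappings $f=h+\overline{g}$ in $\mathbb{D}$ with $h(0)=g(0)=0$, $h'(0)=1$. *)

theory Defs
  imports "HOL-Complex_Analysis.Complex_Analysis"
begin

text \<open>
  Functions on the unit disc are total functions of type \<open>complex \<Rightarrow> complex\<close> of which only the
  values on the disc matter.
\<close>

abbreviation unit_disc :: "complex set" where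
  "unit_disc \<equiv> ball 0 1"

definition locally_univalent :: "(complex \<Rightarrow> complex) \<Rightarrow> bool" where
  "locally_univalent f \<longleftrightarrow>
     (\<forall>z\<in>unit_disc. \<exists>U. open U \<and> z \<in> U \<and> U \<subseteq> unit_disc \<and> inj_on f U)"

definition disc_auto :: "complex \<Rightarrow> complex \<Rightarrow> complex" where
  "disc_auto a z = (z + a) / (1 + cnj a * z)"

text \<open>
  Membership of the Koebe transform in the family is required only up to equality on the disc,
  because the values of the transform off the disc have no meaning.
\<close>

definition linear_invariant_family :: "(complex \<Rightarrow> complex) set \<Rightarrow> bool" where
  "linear_invariant_family L \<longleftrightarrow>
     (\<forall>\<phi>\<in>L. \<phi> holomorphic_on unit_disc \<and> locally_univalent \<phi> \<and> \<phi> 0 = 0 \<and> deriv \<phi> 0 = 1) \<and>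
     (\<forall>\<phi>\<in>L. \<forall>a\<in>unit_disc. \<exists>\<psi>\<in>L. \<forall>z\<in>unit_disc.
        \<psi> z = (\<phi> (disc_auto a z) - \<phi> a) / (of_real (1 - (cmod a)\<^sup>2) * deriv \<phi> a))"

definition taylor_coeff2 :: "(complex \<Rightarrow> complex) \<Rightarrow> complex" where
  "taylor_coeff2 \<phi> = (deriv ^^ 2) \<phi> 0 / fact 2"

text \<open>The order takes extended real values, so that an unbounded family has order \<open>\<infinity>\<close>.\<close>

definition family_order :: "(complex \<Rightarrow> complex) set \<Rightarrow> ereal" where
  "family_order L = (SUP \<phi>\<in>L. ereal (cmod (taylor_coeff2 \<phi>)))"

text \<open>
  The analytic logarithm on the disc that vanishes at the origin. For a nonvanishing holomorphic
  \<open>f\<close> with \<open>f 0 = 1\<close> it exists and is unique on the disc.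
\<close>

definition branch_log :: "(complex \<Rightarrow> complex) \<Rightarrow> complex \<Rightarrow> complex" where
  "branch_log f = (SOME l. l holomorphic_on unit_disc \<and> l 0 = 0 \<and>
                           (\<forall>z\<in>unit_disc. exp (l z) = f z))"

lemma branch_log:
  assumes "f holomorphic_on unit_disc" "f 0 = 1" "\<And>z. z \<in> unit_disc \<Longrightarrow> f z \<noteq> 0"
  shows "branch_log f holomorphic_on unit_disc" "branch_log f 0 = 0"
    "\<And>z. z \<in> unit_disc \<Longrightarrow> exp (branch_log f z) = f z"
proof -
  have "contractible unit_disc"
    by (simp add: convex_imp_contractible)
  then obtain g where g: "g holomorphic_on unit_disc" "\<And>z. z \<in> unit_disc \<Longrightarrow> f z = exp (g z)"
    using contractible_imp_holomorphic_log [OF assms(1)] assms(3) by metis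
  have "exp (g 0) = 1"
    using g(2) [of 0] assms(2) by simp
  then have "\<exists>l. l holomorphic_on unit_disc \<and> l 0 = 0 \<and> (\<forall>z\<in>unit_disc. exp (l z) = f z)"
    using g by (intro exI [of _ "\<lambda>z. g z - g 0"]) (auto intro!: holomorphic_intros simp: exp_diff)
  from someI_ex [OF this, folded branch_log_def]
  show "branch_log f holomorphic_on unit_disc" "branch_log f 0 = 0"
    "\<And>z. z \<in> unit_disc \<Longrightarrow> exp (branch_log f z) = f z"
    by auto
qed

text \<open>
  The function \<open>\<phi> \<zeta> / (\<zeta> (1 - \<zeta>)\<^sup>\<beta>)\<close> with its removable singularity at the origin filled in.
  Since \<open>Re (1 - \<zeta>) > 0\<close> on the disc, the principal power is the analytic branch of
  \<open>(1 - \<zeta>)\<^sup>\<beta>\<close> with value 1 at the origin.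
\<close>

definition C_base :: "real \<Rightarrow> (complex \<Rightarrow> complex) \<Rightarrow> complex \<Rightarrow> complex" where
  "C_base \<beta> \<phi> \<zeta> =
     (if \<zeta> = 0 then deriv \<phi> 0 else \<phi> \<zeta> / \<zeta>) / (1 - \<zeta>) powr of_real \<beta>"

definition C_op :: "real \<Rightarrow> real \<Rightarrow> (complex \<Rightarrow> complex) \<Rightarrow> complex \<Rightarrow> complex" where
  "C_op \<alpha> \<beta> \<phi> z =
     contour_integral (linepath 0 z) (\<lambda>\<zeta>. exp (of_real \<alpha> * branch_log (C_base \<beta> \<phi>) \<zeta>))"

definition C_rot :: "real \<Rightarrow> real \<Rightarrow> real \<Rightarrow> (complex \<Rightarrow> complex) \<Rightarrow> complex \<Rightarrow> complex" where
  "C_rot \<theta> \<alpha> \<beta> \<phi> z = exp (- \<i> * of_real \<theta>) * C_op \<alpha> \<beta> \<phi> (exp (\<i> * of_real \<theta>) * z)"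

text \<open>\<open>H + cnj G\<close> is the normalised horizontal shear of \<open>C\<close> with dilatation \<open>\<omega>\<close>.\<close>

definition horizontal_shear ::
  "(complex \<Rightarrow> complex) \<Rightarrow> (complex \<Rightarrow> complex) \<Rightarrow> (complex \<Rightarrow> complex) \<Rightarrow> (complex \<Rightarrow> complex) \<Rightarrow> bool"
where
  "horizontal_shear C \<omega> H G \<longleftrightarrow>
     H holomorphic_on unit_disc \<and> G holomorphic_on unit_disc \<and>
     (\<forall>z\<in>unit_disc. H z - G z = C z) \<and>
     (\<forall>z\<in>unit_disc. deriv G z = \<omega> z * deriv H z) \<and>
     H 0 = 0 \<and> G 0 = 0 \<and> deriv H 0 = 1 \<and> deriv G 0 = 0"

definition sense_preserving :: "(complex \<Rightarrow> complex) \<Rightarrow> (complex \<Rightarrow> complex) \<Rightarrow> bool" where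
  "sense_preserving H G \<longleftrightarrow> (\<forall>z\<in>unit_disc. (cmod (deriv H z))\<^sup>2 - (cmod (deriv G z))\<^sup>2 > 0)"

definition S_H :: "(complex \<Rightarrow> complex) set" where
  "S_H = {f. inj_on f unit_disc \<and>
             (\<exists>h g. h holomorphic_on unit_disc \<and> g holomorphic_on unit_disc \<and>
                    (\<forall>z\<in>unit_disc. f z = h z + cnj (g z)) \<and>
                    h 0 = 0 \<and> g 0 = 0 \<and> deriv h 0 = 1)}"

text \<open>
  For holomorphic self-maps of the disc both real suprema below are over sets bounded by 1
  (the second by the Schwarz-Pick lemma).
\<close>

definition sup_norm :: "(complex \<Rightarrow> complex) \<Rightarrow> real" where
  "sup_norm w = (SUP z\<in>unit_disc. cmod (w z))"

definition hyp_norm :: "(complex \<Rightarrow> complex) \<Rightarrow> real" where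
  "hyp_norm w =
     (SUP z\<in>unit_disc. cmod (deriv w z) * (1 - (cmod z)\<^sup>2) / (1 - (cmod (w z))\<^sup>2))"

end

theory Submission
  imports Defs
begin

text \<open>
  A harmonic mapping \<open>H + cnj G\<close> is injective as soon as every analytic function \<open>H + \<mu> G\<close> with
  \<open>|\<mu>| = 1\<close> is: a coincidence of values of the former is, for the \<open>\<mu>\<close> with
  \<open>\<mu> (G a - G b) = cnj (G a - G b)\<close>, a coincidence of values of the latter. For the shear of \<open>C\<close> with
  dilatation \<open>\<omega>\<close> one has \<open>H' + \<mu> G' = C' T\<close> with \<open>T = (1 + \<mu> \<omega>) / (1 - \<omega>)\<close>, so the question is
  the univalence of analytic functions with an explicit derivative.

  It is answered by a Loewner chain (\<open>loewner_univalence\<close>): \<open>f\<close> is univalent if some zero-free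
  comparison function \<open>q\<close> satisfies \<open>|f'/q - 1| < 1\<close> and
  \<open>|r\<^sup>2 (f'/q - 1) + (1 - r\<^sup>2) z q'/q| \<le> 1\<close> where \<open>r = |z|\<close>. The choice \<open>q = f'\<close> is Becker's criterion.
  Here \<open>q\<close> is \<open>C' T\<^sup>\<nu> / (1 - \<alpha> \<beta>)\<close>, which splits the left-hand side into three independent costs.

  The factor \<open>\<phi> \<zeta> / \<zeta>\<close> costs at most \<open>\<alpha> (\<gamma> (1 + r) + 1 - r\<^sup>2)\<close>, because
  \<open>(1 - r\<^sup>2) |\<zeta> \<phi>' / \<phi>| \<le> \<gamma> (1 + r)\<close> (\<open>univalent_log_derivative_bound\<close>). The factor \<open>(1 - \<zeta>)\<^sup>-\<^sup>\<beta>\<close>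
  costs at most \<open>\<alpha> \<beta> r\<close>: the constant \<open>1 - \<alpha> \<beta>\<close> in \<open>q\<close> recentres the values of
  \<open>(1 - r\<^sup>2) \<zeta> / (1 - \<zeta>)\<close>, and this halves the cost that Becker's criterion would charge. The
  dilatation costs at most \<open>r k\<close> times roughly \<open>2 (1 - \<nu>) |w| + 2 \<nu> |w'| (1 - r\<^sup>2)\<close>, with
  \<open>k = \<alpha> (1 + \<beta>)\<close>; the exponent \<open>\<nu>\<close> decides how much is paid by the size of \<open>w\<close> and how much by its
  hyperbolic derivative.

  With \<open>\<nu> = 1\<close> the dilatation costs \<open>2 r k\<close> times the hyperbolic norm. This fits the bound on \<open>\<alpha>\<close> in
  part (ii)(a) (\<open>interior_budget\<close>), and in parts (i) and (ii)(b) whenever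
  \<open>2 (1 + \<beta>) \<parallel>w\<^sup>*\<parallel> \<le> (1 + \<beta>) \<parallel>w\<^sup>*\<parallel> (1 + \<parallel>w\<parallel>) + \<beta>\<close> (\<open>boundary_budget\<close>). Since the Schwarz-Pick lemma gives
  \<open>\<parallel>w\<^sup>*\<parallel> \<le> \<parallel>w\<parallel>\<close>, that condition can only fail for \<open>\<beta> < 1/3\<close>. There \<open>\<nu> = 18/25\<close> is used. The point is that
  \<open>|w|\<close> and \<open>|w'| (1 - r\<^sup>2)\<close> cannot be large together: by the Schwarz-Pick lemma for \<open>w / \<parallel>w\<parallel>\<close> and by
  the definition of the hyperbolic norm, a large \<open>|w|\<close> forces a small derivative. The trade-off is
  the elementary inequality \<open>shear_key_inequality\<close>.
\<close>

section \<open>Univalence by means of a Loewner chain\<close>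

text \<open>
  The expression is affine in the weight. It is at most 1 in modulus for the weight \<open>r2\<close> and less than
  1 for the weight 1, hence less than 1 for every weight in between.
\<close>

lemma strict_convex_bound:
  fixes A B :: complex and r2 \<sigma> :: real
  assumes "cmod A < 1" and "cmod (of_real r2 * A + of_real (1 - r2) * B) \<le> 1"
    and "r2 < \<sigma>" "\<sigma> \<le> 1" "0 \<le> r2"
  shows "cmod (of_real \<sigma> * A + of_real (1 - \<sigma>) * B) < 1"
proof -
  \<comment> \<open>The weight of the endpoint 1 in the convex combination that represents \<open>\<sigma>\<close>.\<close>
  define t where "t = (\<sigma> - r2) / (1 - r2)"
  have t: "0 < t" "t \<le> 1" using assms by (auto simp: t_def field_simps)
  have "t * (1 - r2) = \<sigma> - r2" using assms by (simp add: t_def)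
  then have \<sigma>: "\<sigma> = (1 - t) * r2 + t" by (simp add: algebra_simps)
  have "of_real \<sigma> * A + of_real (1 - \<sigma>) * B
      = of_real (1 - t) * (of_real r2 * A + of_real (1 - r2) * B) + of_real t * A"
    unfolding \<sigma> by (simp add: algebra_simps)
  also have "cmod \<dots> \<le> (1 - t) * 1 + t * cmod A"
    unfolding norm_mult using t assms(2)
    by (intro order_trans[OF norm_triangle_ineq] add_mono) (simp_all only: norm_mult norm_of_real, auto simp: mult_left_le)
  also have "\<dots> < 1" using t assms(1) by simp
  finally show ?thesis .
qed

text \<open>
  The disc of centre 1 and radius 1 is mapped by inversion onto the half-plane to the right of 1/2.
\<close>

lemma Re_inverse_gt_half:
  fixes v :: complex
  assumes "cmod (v - 1) < 1"
  shows "Re (1 / v) > 1 / 2"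
proof -
  have "(cmod (v - 1))\<^sup>2 < 1" using assms by (simp add: power_less_one_iff)
  then have *: "(Re v)\<^sup>2 + (Im v)\<^sup>2 < 2 * Re v"
    unfolding cmod_power2 by (simp add: power2_eq_square algebra_simps)
  have "v \<noteq> 0" using assms by auto
  then have "0 < (Re v)\<^sup>2 + (Im v)\<^sup>2" by (simp add: complex_neq_0)
  then show ?thesis using * by (simp add: Re_divide field_simps)
qed

text \<open>
  Two points with equal values of a member of the chain cannot merge at a parameter where the
  derivative does not vanish; the neighbourhood is uniform in the parameter \<open>t\<close>. This makes the
  set of bad parameters closed.
\<close>

lemma loewner_locally_injective:
  fixes f N :: "complex \<Rightarrow> complex" and a :: complex and s :: real
  assumes f: "f holomorphic_on unit_disc" and N: "N holomorphic_on unit_disc"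
    and a: "a \<in> unit_disc"
    and nz: "of_real s * deriv f a + of_real (1 - s) * deriv N a \<noteq> 0"
  obtains \<delta> where "\<delta> > 0"
    "\<And>u v t. dist u a < \<delta> \<Longrightarrow> dist v a < \<delta> \<Longrightarrow> dist t s < \<delta> \<Longrightarrow>
       of_real t * f u + of_real (1 - t) * N u = of_real t * f v + of_real (1 - t) * N v \<Longrightarrow> u = v"
proof -
  define d where "d = of_real s * deriv f a + of_real (1 - s) * deriv N a"
  define D where "D = (\<lambda>x::complex \<times> real. of_real (snd x) * deriv f (fst x) + of_real (1 - snd x) * deriv N (fst x))"
  have "isCont (deriv f) a" "isCont (deriv N) a"
    using a f N by (auto intro!: continuous_on_interior[of unit_disc] holomorphic_on_imp_continuous_on
      holomorphic_deriv)
  then have "isCont D (a, s)"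
    unfolding D_def
    by (intro continuous_intros isCont_o2[of "(a, s)" fst "deriv f"] isCont_o2[of "(a, s)" fst "deriv N"]) auto
  moreover have "cmod d / 2 > 0" using nz by (simp add: d_def)
  ultimately obtain e where e: "e > 0" "\<And>x. dist x (a, s) < e \<Longrightarrow> dist (D x) (D (a, s)) < cmod d / 2"
    unfolding continuous_at_eps_delta by blast
  define \<delta> where "\<delta> = min (e / 2) (1 - cmod a)"
  have \<delta>: "\<delta> > 0" using e a by (auto simp: \<delta>_def)
  have sub: "ball a \<delta> \<subseteq> unit_disc"
  proof
    fix z assume "z \<in> ball a \<delta>"
    then have "dist a z < 1 - cmod a" by (simp add: \<delta>_def)
    then show "z \<in> unit_disc"
      using norm_triangle_ineq2[of z a] by (simp add: dist_norm norm_minus_commute)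
  qed
  show ?thesis
  proof (rule that[OF \<delta>])
    fix u v t
    assume uv: "dist u a < \<delta>" "dist v a < \<delta>" and t: "dist t s < \<delta>"
      and eq: "of_real t * f u + of_real (1 - t) * N u = of_real t * f v + of_real (1 - t) * N v"
    define g where "g = (\<lambda>z. of_real t * f z + of_real (1 - t) * N z - d * z)"
    have der: "(g has_field_derivative D (z, t) - d) (at z within ball a \<delta>)" if "z \<in> ball a \<delta>" for z
    proof -
      have "z \<in> unit_disc" using sub that by auto
      then have "(f has_field_derivative deriv f z) (at z within ball a \<delta>)"
         "(N has_field_derivative deriv N z) (at z within ball a \<delta>)"
        using f N by (auto intro: holomorphic_derivI DERIV_subset has_field_derivative_at_within)
      then show ?thesis unfolding g_def D_def by (auto intro!: derivative_eq_intros)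
    qed
    have "cmod (D (z, t) - d) \<le> cmod d / 2" if "z \<in> ball a \<delta>" for z
    proof -
      have "dist (z, t) (a, s) \<le> dist z a + dist t s"
        by (simp add: dist_Pair_Pair sqrt_sum_squares_le_sum)
      also have "\<dots> < e" using that t by (simp add: \<delta>_def dist_commute)
      finally have "dist (D (z, t)) (D (a, s)) < cmod d / 2" by (rule e)
      moreover have "D (a, s) = d" by (simp add: D_def d_def)
      ultimately show ?thesis by (simp add: dist_norm)
    qed
    then have "cmod (g u - g v) \<le> cmod d / 2 * cmod (u - v)"
      using uv der by (intro field_differentiable_bound[of "ball a \<delta>" g]) (auto simp: dist_commute)
    moreover have "g u - g v = - d * (u - v)"
      using eq by (simp add: g_def algebra_simps)
    ultimately have "cmod d * cmod (u - v) \<le> cmod d / 2 * cmod (u - v)"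
      by (simp add: norm_mult)
    moreover have "cmod d > 0" using nz by (simp add: d_def)
    ultimately have "\<not> cmod (u - v) > 0" using mult_pos_pos[of "cmod d" "cmod (u - v)"] by linarith
    then show "u = v" by simp
  qed
qed

text \<open>
  In the chain \<open>f \<zeta> + x \<zeta> q \<zeta>\<close> the point with a prescribed value moves with \<open>x\<close>. Here \<open>|\<zeta>|\<^sup>2 (1 + x)\<close> is the
  squared modulus in the usual normalisation \<open>\<zeta> = z e\<^sup>-\<^sup>t\<close>, \<open>1 + x = e\<^sup>2\<^sup>t\<close> of the chain. The hypothesis says
  that the Loewner velocity has positive real part, so this quantity decreases. The moving point is
  found by solving for \<open>x\<close> as an analytic function of \<open>\<zeta>\<close> and inverting that function.
\<close>

lemma loewner_flow_inward:
  fixes f q :: "complex \<Rightarrow> complex" and a :: complex and x \<epsilon> :: real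
  assumes f: "f holomorphic_on unit_disc" and q: "q holomorphic_on unit_disc"
    and a: "a \<in> unit_disc" "q a \<noteq> 0" and x: "x \<ge> 0" and \<epsilon>: "\<epsilon> > 0"
    and v: "cmod ((deriv f a + of_real x * (q a + a * deriv q a)) / (of_real (1 + x) * q a) - 1) < 1"
  obtains \<delta> where "\<delta> > 0"
    "\<And>t. x < t \<Longrightarrow> t < x + \<delta> \<Longrightarrow>
       \<exists>b. dist b a < \<epsilon> \<and> f b + of_real t * (b * q b) = f a + of_real x * (a * q a)
         \<and> (cmod b)\<^sup>2 * (1 + t) \<le> (cmod a)\<^sup>2 * (1 + x)"
proof (cases "a = 0")
  case True
  show ?thesis
  proof (rule that[of 1])
    fix t show "\<exists>b. dist b a < \<epsilon> \<and> f b + of_real t * (b * q b) = f a + of_real x * (a * q a)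
         \<and> (cmod b)\<^sup>2 * (1 + t) \<le> (cmod a)\<^sup>2 * (1 + x)"
      by (rule exI[of _ a]) (use True \<epsilon> in auto)
  qed simp
next
  case False
  \<comment> \<open>The point \<open>b\<close> has the value \<open>c\<close> at parameter \<open>t\<close> exactly if \<open>X b = t\<close>.\<close>
  define c where "c = f a + of_real x * (a * q a)"
  define X where "X = (\<lambda>z. (c - f z) / (z * q z))"
  define S where "S = {z \<in> unit_disc - {0}. q z \<noteq> 0} \<inter> ball a \<epsilon>"
  define d where "d = deriv f a + of_real x * (q a + a * deriv q a)"
  have "openin (top_of_set (unit_disc - {0})) ((unit_disc - {0}) \<inter> q -` (- {0}))"
    by (rule continuous_openin_preimage_gen)
       (auto intro: holomorphic_on_imp_continuous_on holomorphic_on_subset[OF q])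
  then have "open ((unit_disc - {0}) \<inter> q -` (- {0}))"
    by (metis open_delete open_ball openin_open_eq inf.absorb_iff2 openin_open_trans)
  moreover have "S = ((unit_disc - {0}) \<inter> q -` (- {0})) \<inter> ball a \<epsilon>" by (auto simp: S_def)
  ultimately have S: "open S" by auto
  have aS: "a \<in> S" using a False \<epsilon> by (auto simp: S_def)
  have holX: "X holomorphic_on S"
    unfolding X_def S_def
    by (intro holomorphic_intros holomorphic_on_subset[OF f] holomorphic_on_subset[OF q]) auto
  have Xa: "X a = of_real x" using a False by (simp add: X_def c_def)
  have derf: "(f has_field_derivative deriv f a) (at a)" and derq: "(q has_field_derivative deriv q a) (at a)"
    using f q a by (auto intro: holomorphic_derivI)
  have "(X has_field_derivative (- deriv f a * (a * q a) - (c - f a) * (q a + a * deriv q a)) / (a * q a * (a * q a))) (at a)"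
    unfolding X_def using a False
    by (auto intro!: derivative_eq_intros derf derq simp: algebra_simps)
  also have "(- deriv f a * (a * q a) - (c - f a) * (q a + a * deriv q a)) / (a * q a * (a * q a)) = - d / (a * q a)"
    using a False by (simp add: c_def d_def field_simps)
  finally have dX: "(X has_field_derivative - d / (a * q a)) (at a)" .
  define w where "w = d / (of_real (1 + x) * q a)"
  have w: "cmod (w - 1) < 1" using v by (simp add: w_def d_def)
  have cx: "1 + complex_of_real x \<noteq> 0"
    using x by (metis add_nonneg_pos less_add_same_cancel1 less_numeral_extra(1) less_irrefl of_real_1 of_real_add of_real_eq_0_iff add.commute)
  have dw: "d = of_real (1 + x) * q a * w" using a cx by (simp add: w_def)
  have "w \<noteq> 0" using w by auto
  then have d0: "d \<noteq> 0" using dw a cx by auto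
  then have "deriv X a \<noteq> 0" using DERIV_imp_deriv[OF dX] a False by simp
  then obtain \<rho> where \<rho>: "\<rho> > 0" "ball a \<rho> \<subseteq> S" "open (X ` ball a \<rho>)" "inj_on X (ball a \<rho>)"
    using has_complex_derivative_locally_invertible[OF holX aS S] by metis
  obtain g where g: "g holomorphic_on (X ` ball a \<rho>)"
      "\<And>z. z \<in> ball a \<rho> \<Longrightarrow> deriv X z * deriv g (X z) = 1" "\<And>z. z \<in> ball a \<rho> \<Longrightarrow> g (X z) = z"
    using holomorphic_has_inverse[OF holomorphic_on_subset[OF holX \<rho>(2)] open_ball \<rho>(4)] by metis
  have xin: "of_real x \<in> X ` ball a \<rho>" using Xa \<rho>(1) by (metis centre_in_ball imageI)
  have ga: "g (of_real x) = a" using g(3)[of a] Xa \<rho> by simp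
  have dg: "deriv g (of_real x) = - (a * q a) / d"
  proof -
    have "- d / (a * q a) * deriv g (of_real x) = 1"
      using g(2)[of a] Xa \<rho>(1) DERIV_imp_deriv[OF dX] by simp
    then have "- (d * deriv g (of_real x)) = a * q a" using a False by (simp add: field_simps)
    then have "d * deriv g (of_real x) = - (a * q a)" by (metis minus_minus)
    then show ?thesis using d0 by (simp add: field_simps)
  qed
  have gder: "(g has_field_derivative - (a * q a) / d) (at (of_real x))"
    using holomorphic_derivI[OF g(1) \<rho>(3) xin] dg by simp
  define G where "G = (\<lambda>t::real. g (of_real t))"
  have Gder: "(G has_vector_derivative - (a * q a) / d) (at x)"
    unfolding G_def using has_vector_derivative_real_field[OF gder] by simp
  define h where "h = (\<lambda>t. ((Re (G t))\<^sup>2 + (Im (G t))\<^sup>2) * (1 + t))"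
  define e where "e = - (a * q a) / d"
  have ReG: "((\<lambda>t. Re (G t)) has_real_derivative Re e) (at x)"
    and ImG: "((\<lambda>t. Im (G t)) has_real_derivative Im e) (at x)"
    unfolding e_def by (rule has_field_derivative_Re[OF Gder], rule has_field_derivative_Im[OF Gder])
  have "(h has_real_derivative 2 * Re (cnj a * e) * (1 + x) + (cmod a)\<^sup>2) (at x)"
    unfolding h_def
    by (rule ReG ImG derivative_eq_intros refl)+ (simp add: G_def ga cmod_power2 algebra_simps)
  also have "cnj a * e = - (a * cnj a) / (of_real (1 + x) * w)"
    unfolding e_def dw using a by simp
  also have "\<dots> = - of_real ((cmod a)\<^sup>2 / (1 + x)) * (1 / w)"
    using complex_norm_square[of a] by simp
  also have "Re (- of_real ((cmod a)\<^sup>2 / (1 + x)) * (1 / w)) = - ((cmod a)\<^sup>2 / (1 + x)) * Re (1 / w)"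
    by (metis Re_complex_of_real of_real_minus scaleR_complex.simps(1) scaleR_conv_of_real)
  also have "2 * (- ((cmod a)\<^sup>2 / (1 + x)) * Re (1 / w)) * (1 + x) + (cmod a)\<^sup>2 = (cmod a)\<^sup>2 * (1 - 2 * Re (1 / w))"
    using x by (simp add: field_simps)
  finally have "(h has_real_derivative (cmod a)\<^sup>2 * (1 - 2 * Re (1 / w))) (at x)" .
  moreover have "(cmod a)\<^sup>2 * (1 - 2 * Re (1 / w)) < 0"
    using Re_inverse_gt_half[OF w] False by (simp add: mult_pos_neg)
  ultimately obtain e1 where e1: "e1 > 0" "\<And>s. 0 < s \<Longrightarrow> s < e1 \<Longrightarrow> h (x + s) < h x"
    using DERIV_neg_dec_right by metis
  obtain e2 where e2: "e2 > 0" "ball (complex_of_real x) e2 \<subseteq> X ` ball a \<rho>"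
    using \<rho>(3) xin open_contains_ball by metis
  show ?thesis
  proof (rule that[of "min e1 e2"])
    show "min e1 e2 > 0" using e1 e2 by simp
    fix t assume t: "x < t" "t < x + min e1 e2"
    have "dist (complex_of_real x) (of_real t) < e2" using t by (simp add: dist_of_real dist_real_def)
    then obtain b where b: "b \<in> ball a \<rho>" "X b = of_real t" using e2 by (metis imageE mem_ball subsetD)
    have "b \<in> S" using b \<rho> by auto
    then have bS: "b \<noteq> 0" "q b \<noteq> 0" "dist b a < \<epsilon>" by (auto simp: S_def dist_commute)
    have gb: "G t = b" using g(3)[OF b(1)] b(2) by (simp add: G_def)
    have "c - f b = of_real t * (b * q b)" using b(2) bS by (simp add: X_def field_simps)
    then have "f b + of_real t * (b * q b) = c" by (simp add: algebra_simps)
    moreover have "(cmod b)\<^sup>2 * (1 + t) \<le> (cmod a)\<^sup>2 * (1 + x)"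
      using e1(2)[of "t - x"] t min.cobounded1[of e1 e2] gb ga by (simp add: h_def cmod_power2 G_def)
    ultimately show "\<exists>b. dist b a < \<epsilon> \<and> f b + of_real t * (b * q b) = f a + of_real x * (a * q a)
         \<and> (cmod b)\<^sup>2 * (1 + t) \<le> (cmod a)\<^sup>2 * (1 + x)"
      using bS c_def by auto
  qed
qed

text \<open>
  Rescaling the chain by \<open>s = 1 / (1 + x)\<close> gives \<open>s f + (1 - s) \<zeta> q\<close> on the disc
  \<open>|\<zeta>|\<^sup>2 \<le> s R\<^sup>2\<close>. Two points of the disc \<open>|\<zeta>| \<le> R\<close> with the same image under \<open>f\<close> are a coincidence at
  \<open>s = 1\<close>. Coincidences persist in the limit by local injectivity, including at \<open>s = 0\<close>, where the disc
  shrinks to the origin and the derivative is \<open>q 0\<close>. So there is a smallest parameter with a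
  coincidence, and it is positive; but the inward flow continues it to smaller parameters.
\<close>

lemma loewner_univalence:
  fixes f q :: "complex \<Rightarrow> complex"
  assumes f: "f holomorphic_on unit_disc" and q: "q holomorphic_on unit_disc"
    and nz: "\<And>z. z \<in> unit_disc \<Longrightarrow> q z \<noteq> 0"
    and small: "\<And>z. z \<in> unit_disc \<Longrightarrow> cmod (deriv f z / q z - 1) < 1"
    and bound: "\<And>z. z \<in> unit_disc \<Longrightarrow>
      cmod (of_real ((cmod z)\<^sup>2) * (deriv f z / q z - 1)
            + of_real (1 - (cmod z)\<^sup>2) * (z * deriv q z / q z)) \<le> 1"
  shows "inj_on f unit_disc"
proof (rule ccontr)
  assume "\<not> inj_on f unit_disc"
  then obtain a0 b0 where ab0: "a0 \<in> unit_disc" "b0 \<in> unit_disc" "a0 \<noteq> b0" "f a0 = f b0"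
    by (auto simp: inj_on_def)
  define R where "R = max (cmod a0) (cmod b0)"
  have R: "0 \<le> R" "R < 1" using ab0 by (auto simp: R_def max_def)
  then have R2: "R\<^sup>2 < 1" by (simp add: power_less_one_iff)
  define N where "N = (\<lambda>z. z * q z)"
  have N: "N holomorphic_on unit_disc" unfolding N_def by (intro holomorphic_intros q)
  have dN: "deriv N z = q z + z * deriv q z" if "z \<in> unit_disc" for z
    unfolding N_def using that q
    by (intro DERIV_imp_deriv) (auto intro!: derivative_eq_intros holomorphic_derivI[of q unit_disc])
  define M where "M = (\<lambda>s z. of_real s * f z + of_real (1 - s) * N z)"
  have key: "cmod (of_real s * (deriv f z / q z - 1) + of_real (1 - s) * (z * deriv q z / q z)) < 1"
    if "(cmod z)\<^sup>2 \<le> s * R\<^sup>2" "0 \<le> s" "s \<le> 1" for s z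
  proof (cases "z = 0")
    case True
    have "s * cmod (deriv f 0 / q 0 - 1) \<le> 1 * cmod (deriv f 0 / q 0 - 1)"
      using that by (intro mult_right_mono) auto
    also have "\<dots> < 1" using small[of 0] by simp
    finally show ?thesis using True that by (simp add: norm_mult)
  next
    case False
    then have "s > 0" using that by (metis less_eq_real_def mult_zero_left norm_le_zero_iff power2_less_eq_zero_iff not_less)
    then have "s * R\<^sup>2 < s" using R2 by simp
    then have "(cmod z)\<^sup>2 < s" using that by simp
    moreover from this have "z \<in> unit_disc" using that power2_less_imp_less[of "cmod z" "1::real"] by simp
    ultimately show ?thesis
      using strict_convex_bound[OF small[of z] bound[of z], of s] that by simp
  qed
  have disc: "z \<in> unit_disc" if "(cmod z)\<^sup>2 \<le> s * R\<^sup>2" "0 \<le> s" "s \<le> 1" for s z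
  proof -
    have "s * R\<^sup>2 \<le> 1 * R\<^sup>2" using that by (intro mult_right_mono) auto
    then show ?thesis using that R2 power2_less_imp_less[of "cmod z" "1::real"] by simp
  qed
  have factor: "of_real s * deriv f z + of_real (1 - s) * deriv N z
      = q z * (1 + (of_real s * (deriv f z / q z - 1) + of_real (1 - s) * (z * deriv q z / q z)))"
    if "z \<in> unit_disc" for s z
    using nz[OF that] dN[OF that] by (simp add: field_simps)
  have nonzero: "of_real s * deriv f z + of_real (1 - s) * deriv N z \<noteq> 0"
    if "(cmod z)\<^sup>2 \<le> s * R\<^sup>2" "0 \<le> s" "s \<le> 1" for s z
  proof -
    have "1 + (of_real s * (deriv f z / q z - 1) + of_real (1 - s) * (z * deriv q z / q z)) \<noteq> 0"
      using key[OF that] by (metis add_eq_0_iff less_irrefl norm_minus_cancel norm_one)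
    then show ?thesis using factor nz disc[OF that] by simp
  qed
  define Z where "Z = {s. 0 \<le> s \<and> s \<le> 1 \<and>
     (\<exists>a b. a \<noteq> b \<and> (cmod a)\<^sup>2 \<le> s * R\<^sup>2 \<and> (cmod b)\<^sup>2 \<le> s * R\<^sup>2 \<and> M s a = M s b)}"
  have "1 \<in> Z"
  proof -
    have "(cmod a0)\<^sup>2 \<le> 1 * R\<^sup>2" "(cmod b0)\<^sup>2 \<le> 1 * R\<^sup>2"
      by (auto simp: R_def intro!: power_mono)
    moreover have "M 1 a0 = M 1 b0" using ab0 by (simp add: M_def)
    ultimately show ?thesis using ab0(3) unfolding Z_def
      by (intro CollectI conjI exI[of _ a0] exI[of _ b0]) auto
  qed
  define s0 where "s0 = Inf Z"
  have bdd: "bdd_below Z" unfolding Z_def by (auto intro!: bdd_belowI[of _ 0])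
  have "s0 \<in> closure Z" unfolding s0_def using \<open>1 \<in> Z\<close> bdd by (intro closure_contains_Inf) auto
  then obtain sq where sq: "\<And>n. sq n \<in> Z" "sq \<longlonglongrightarrow> s0" by (auto simp: closure_sequential)
  have "\<forall>n. \<exists>a b. a \<noteq> b \<and> (cmod a)\<^sup>2 \<le> sq n * R\<^sup>2 \<and> (cmod b)\<^sup>2 \<le> sq n * R\<^sup>2 \<and> M (sq n) a = M (sq n) b"
    using sq(1) by (auto simp: Z_def)
  then obtain A B where AB: "\<And>n. A n \<noteq> B n" "\<And>n. (cmod (A n))\<^sup>2 \<le> sq n * R\<^sup>2"
      "\<And>n. (cmod (B n))\<^sup>2 \<le> sq n * R\<^sup>2" "\<And>n. M (sq n) (A n) = M (sq n) (B n)"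
    by metis
  have s0: "0 \<le> s0" "s0 \<le> 1"
    using LIMSEQ_le_const[OF sq(2), of 0] LIMSEQ_le_const2[OF sq(2), of 1] sq(1) by (auto simp: Z_def)
  have sqR: "sq n * R\<^sup>2 \<le> 1" for n
  proof -
    have "sq n \<le> 1" "0 \<le> sq n" using sq(1)[of n] by (auto simp: Z_def)
    then show ?thesis using R2 by (simp add: mult_le_one)
  qed
  have in_ball: "(A n, B n) \<in> cball 0 1 \<times> cball 0 1" for n
  proof -
    have "(cmod (A n))\<^sup>2 \<le> 1\<^sup>2" "(cmod (B n))\<^sup>2 \<le> 1\<^sup>2" using AB(2,3)[of n] sqR[of n] by auto
    then show ?thesis using power2_le_imp_le[of _ "1::real"] by auto
  qed
  have "seq_compact (cball (0::complex) 1 \<times> cball (0::complex) 1)"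
    by (intro compact_imp_seq_compact compact_Times) auto
  then obtain l r where lr: "strict_mono r" "((\<lambda>n. (A n, B n)) \<circ> r) \<longlonglongrightarrow> l"
    by (rule seq_compactE) (use in_ball in auto)
  obtain a b where l: "l = (a, b)" by (cases l)
  have lim: "(\<lambda>n. A (r n)) \<longlonglongrightarrow> a" "(\<lambda>n. B (r n)) \<longlonglongrightarrow> b" "(\<lambda>n. sq (r n)) \<longlonglongrightarrow> s0"
    using tendsto_fst[OF lr(2)] tendsto_snd[OF lr(2)] LIMSEQ_subseq_LIMSEQ[OF sq(2) lr(1)]
    by (auto simp: l o_def)
  have a: "(cmod a)\<^sup>2 \<le> s0 * R\<^sup>2"
    by (rule LIMSEQ_le[of "\<lambda>n. (cmod (A (r n)))\<^sup>2" _ "\<lambda>n. sq (r n) * R\<^sup>2"])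
       (use AB(2) in \<open>auto intro!: tendsto_intros lim\<close>)
  have b: "(cmod b)\<^sup>2 \<le> s0 * R\<^sup>2"
    by (rule LIMSEQ_le[of "\<lambda>n. (cmod (B (r n)))\<^sup>2" _ "\<lambda>n. sq (r n) * R\<^sup>2"])
       (use AB(3) in \<open>auto intro!: tendsto_intros lim\<close>)
  have aD: "a \<in> unit_disc" and bD: "b \<in> unit_disc" using disc a b s0 by auto
  have "a \<noteq> b"
  proof
    assume "a = b"
    obtain \<delta> where \<delta>: "\<delta> > 0"
       "\<And>u v t. dist u a < \<delta> \<Longrightarrow> dist v a < \<delta> \<Longrightarrow> dist t s0 < \<delta> \<Longrightarrow>
       of_real t * f u + of_real (1 - t) * N u = of_real t * f v + of_real (1 - t) * N v \<Longrightarrow> u = v"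
      using loewner_locally_injective[OF f N aD nonzero[OF a s0]] by blast
    have "\<forall>\<^sub>F n in sequentially. dist (A (r n)) a < \<delta>" "\<forall>\<^sub>F n in sequentially. dist (B (r n)) a < \<delta>"
      "\<forall>\<^sub>F n in sequentially. dist (sq (r n)) s0 < \<delta>"
      using lim \<delta>(1) \<open>a = b\<close> by (auto intro: tendstoD)
    then have "\<forall>\<^sub>F n in sequentially. A (r n) = B (r n)"
      by eventually_elim (use \<delta>(2) AB(4) in \<open>simp add: M_def\<close>)
    then show False using AB(1) by (simp add: eventually_sequentially)
  qed
  have contM: "isCont (\<lambda>z. h z) z" if "h holomorphic_on unit_disc" "z \<in> unit_disc" for h :: "complex \<Rightarrow> complex" and z
    using that holomorphic_on_imp_continuous_on[OF that(1)]
    by (simp add: continuous_on_eq_continuous_at)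
  have eq: "M s0 a = M s0 b"
  proof (rule LIMSEQ_unique)
    show "(\<lambda>n. M (sq (r n)) (A (r n))) \<longlonglongrightarrow> M s0 a"
      unfolding M_def
      by (intro tendsto_intros lim isCont_tendsto_compose[OF contM[OF f aD]] isCont_tendsto_compose[OF contM[OF N aD]])
    have "(\<lambda>n. M (sq (r n)) (B (r n))) \<longlonglongrightarrow> M s0 b"
      unfolding M_def
      by (intro tendsto_intros lim isCont_tendsto_compose[OF contM[OF f bD]] isCont_tendsto_compose[OF contM[OF N bD]])
    then show "(\<lambda>n. M (sq (r n)) (A (r n))) \<longlonglongrightarrow> M s0 b" by (simp only: AB(4))
  qed
  have "s0 \<noteq> 0" using a b \<open>a \<noteq> b\<close> by auto
  then have s0pos: "s0 > 0" using s0 by simp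
  define x where "x = 1 / s0 - 1"
  have x: "x \<ge> 0" "1 + x = 1 / s0" using s0 s0pos by (auto simp: x_def)
  have s0C: "complex_of_real s0 \<noteq> 0" using s0pos by simp
  have vel: "cmod ((deriv f c + of_real x * (q c + c * deriv q c)) / (of_real (1 + x) * q c) - 1) < 1"
    if c: "(cmod c)\<^sup>2 \<le> s0 * R\<^sup>2" for c
  proof -
    have cD: "c \<in> unit_disc" using disc[OF c s0] .
    have "(deriv f c + of_real x * (q c + c * deriv q c)) / (of_real (1 + x) * q c) - 1
       = of_real s0 * (deriv f c / q c - 1) + of_real (1 - s0) * (c * deriv q c / q c)"
      using nz[OF cD] s0C unfolding x by (simp add: x_def field_simps)
    then show ?thesis using key[OF c s0] by simp
  qed
  have \<epsilon>: "dist a b / 2 > 0" using \<open>a \<noteq> b\<close> by simp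
  obtain \<delta>1 where \<delta>1: "\<delta>1 > 0" "\<And>t. x < t \<Longrightarrow> t < x + \<delta>1 \<Longrightarrow>
       \<exists>c. dist c a < dist a b / 2 \<and> f c + of_real t * (c * q c) = f a + of_real x * (a * q a)
         \<and> (cmod c)\<^sup>2 * (1 + t) \<le> (cmod a)\<^sup>2 * (1 + x)"
    using loewner_flow_inward[OF f q aD nz[OF aD] x(1) \<epsilon> vel[OF a]] by blast
  obtain \<delta>2 where \<delta>2: "\<delta>2 > 0" "\<And>t. x < t \<Longrightarrow> t < x + \<delta>2 \<Longrightarrow>
       \<exists>c. dist c b < dist a b / 2 \<and> f c + of_real t * (c * q c) = f b + of_real x * (b * q b)
         \<and> (cmod c)\<^sup>2 * (1 + t) \<le> (cmod b)\<^sup>2 * (1 + x)"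
    using loewner_flow_inward[OF f q bD nz[OF bD] x(1) \<epsilon> vel[OF b]] by blast
  define t where "t = x + min \<delta>1 \<delta>2 / 2"
  have t: "x < t" "t < x + \<delta>1" "t < x + \<delta>2" using \<delta>1(1) \<delta>2(1) by (auto simp: t_def min_def)
  obtain a' where a': "dist a' a < dist a b / 2" "f a' + of_real t * (a' * q a') = f a + of_real x * (a * q a)"
      "(cmod a')\<^sup>2 * (1 + t) \<le> (cmod a)\<^sup>2 * (1 + x)"
    using \<delta>1(2)[OF t(1,2)] by blast
  obtain b' where b': "dist b' b < dist a b / 2" "f b' + of_real t * (b' * q b') = f b + of_real x * (b * q b)"
      "(cmod b')\<^sup>2 * (1 + t) \<le> (cmod b)\<^sup>2 * (1 + x)"
    using \<delta>2(2)[OF t(1,3)] by blast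
  define s1 where "s1 = 1 / (1 + t)"
  have s1: "0 < s1" "s1 \<le> 1" using t x by (auto simp: s1_def)
  have s10: "s1 < s0"
  proof -
    have "1 / (1 + t) < 1 / (1 + x)" using t x(1) by (intro divide_strict_left_mono) auto
    moreover have "s0 = 1 / (1 + x)" using x s0pos by simp
    ultimately show ?thesis by (simp add: s1_def)
  qed
  have unM: "M s z = of_real s * (f z + of_real (1 / s - 1) * (z * q z))" if "s > 0" for s z
    using that by (simp add: M_def N_def field_simps)
  have tC: "1 / s1 - 1 = t" by (simp add: s1_def)
  have "f a + of_real x * (a * q a) = f b + of_real x * (b * q b)"
    using eq unM[OF s0pos] s0C by (simp add: x_def)
  then have "M s1 a' = M s1 b'" unfolding unM[OF s1(1)] tC a'(2) b'(2) by simp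
  moreover have "a' \<noteq> b'"
    using a'(1) b'(1) dist_triangle_half_r[of a' a "dist a b" b] by (auto simp: dist_commute)
  moreover have "(cmod a')\<^sup>2 \<le> s1 * R\<^sup>2"
  proof -
    have "(cmod a)\<^sup>2 * (1 + x) \<le> R\<^sup>2" unfolding x using a s0pos by (simp add: field_simps)
    then have "(cmod a')\<^sup>2 * (1 + t) \<le> R\<^sup>2" using a'(3) by simp
    then show ?thesis using t x by (simp add: s1_def field_simps)
  qed
  moreover have "(cmod b')\<^sup>2 \<le> s1 * R\<^sup>2"
  proof -
    have "(cmod b)\<^sup>2 * (1 + x) \<le> R\<^sup>2" unfolding x using b s0pos by (simp add: field_simps)
    then have "(cmod b')\<^sup>2 * (1 + t) \<le> R\<^sup>2" using b'(3) by simp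
    then show ?thesis using t x by (simp add: s1_def field_simps)
  qed
  ultimately have "s1 \<in> Z" using s1 by (auto simp: Z_def)
  then have "s0 \<le> s1" unfolding s0_def using bdd by (intro cInf_lower)
  then show False using s10 by simp
qed

section \<open>Growth of univalent functions in a linear invariant family\<close>

lemma disc_auto_Moebius: "disc_auto a = Moebius_function 0 (- a)"
  by (simp add: disc_auto_def Moebius_function_def fun_eq_iff)

lemma disc_auto_in_disc: "a \<in> unit_disc \<Longrightarrow> z \<in> unit_disc \<Longrightarrow> disc_auto a z \<in> unit_disc"
  by (simp add: disc_auto_Moebius Moebius_function_norm_lt_1)

lemma disc_auto_denominator: "a \<in> unit_disc \<Longrightarrow> z \<in> unit_disc \<Longrightarrow> 1 + cnj a * z \<noteq> 0"
proof
  assume "a \<in> unit_disc" "z \<in> unit_disc" "1 + cnj a * z = 0"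
  then have "cmod (cnj a * z) = 1" by (metis add_eq_0_iff norm_minus_cancel norm_one)
  moreover have "cmod a * cmod z \<le> cmod a * 1"
    using \<open>z \<in> unit_disc\<close> by (intro mult_left_mono) auto
  ultimately show False using \<open>a \<in> unit_disc\<close> by (simp add: norm_mult)
qed

lemma disc_auto_has_derivative:
  assumes "a \<in> unit_disc" "z \<in> unit_disc"
  shows "(disc_auto a has_field_derivative of_real (1 - (cmod a)\<^sup>2) / (1 + cnj a * z)\<^sup>2) (at z)"
proof -
  have "complex_of_real (1 - (cmod a)\<^sup>2) = 1 - a * cnj a"
    using complex_norm_square[of a] by simp
  then show ?thesis
    unfolding disc_auto_def[abs_def] using disc_auto_denominator[OF assms]
    by (auto intro!: derivative_eq_intros simp: power2_eq_square) (simp add: algebra_simps)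
qed

lemma disc_auto_inj: "a \<in> unit_disc \<Longrightarrow> inj_on (disc_auto a) unit_disc"
proof (rule inj_on_inverseI[of _ "disc_auto (- a)"])
  fix z assume "a \<in> unit_disc" "z \<in> unit_disc"
  then show "disc_auto (- a) (disc_auto a z) = z"
    unfolding disc_auto_Moebius by (intro Moebius_function_compose) auto
qed

lemma linear_invariant_familyD:
  assumes "linear_invariant_family L" "\<phi> \<in> L"
  shows "\<phi> holomorphic_on unit_disc" "\<phi> 0 = 0" "deriv \<phi> 0 = 1"
    "\<And>z. z \<in> unit_disc \<Longrightarrow> deriv \<phi> z \<noteq> 0"
proof -
  show hol: "\<phi> holomorphic_on unit_disc" and "\<phi> 0 = 0" "deriv \<phi> 0 = 1"
    using assms by (auto simp: linear_invariant_family_def)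
  fix z assume "z \<in> unit_disc"
  then obtain U where U: "open U" "z \<in> U" "U \<subseteq> unit_disc" "inj_on \<phi> U"
    using assms unfolding linear_invariant_family_def locally_univalent_def by meson
  then show "deriv \<phi> z \<noteq> 0"
    using holomorphic_injective_imp_regular[of \<phi> U z] hol holomorphic_on_subset by blast
qed

text \<open>
  The left-hand side is the second coefficient of the Koebe transform of \<open>\<phi>\<close> at \<open>a\<close>, which belongs to the
  family again.
\<close>

lemma family_second_coefficient_bound:
  assumes L: "linear_invariant_family L" "family_order L = ereal \<gamma>" "\<phi> \<in> L" and a: "a \<in> unit_disc"
  shows "cmod (of_real ((1 - (cmod a)\<^sup>2) / 2) * (deriv (deriv \<phi>) a / deriv \<phi> a) - cnj a) \<le> \<gamma>"
proof -
  note \<phi> = linear_invariant_familyD[OF L(1,3)]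
  define c where "c = of_real (1 - (cmod a)\<^sup>2) * deriv \<phi> a"
  have "cmod a < 1" using a by simp
  then have "(cmod a)\<^sup>2 < 1" by (simp add: power_less_one_iff)
  then have a2: "complex_of_real (1 - (cmod a)\<^sup>2) \<noteq> 0"
    by (simp only: of_real_eq_0_iff)
  obtain \<psi> where \<psi>: "\<psi> \<in> L" "\<And>z. z \<in> unit_disc \<Longrightarrow> \<psi> z = (\<phi> (disc_auto a z) - \<phi> a) / c"
    using L a unfolding linear_invariant_family_def c_def by blast
  have d\<psi>: "(\<psi> has_field_derivative
      deriv \<phi> (disc_auto a z) * (of_real (1 - (cmod a)\<^sup>2) / (1 + cnj a * z)\<^sup>2) / c) (at z)"
    if z: "z \<in> unit_disc" for z
  proof -
    have "(\<phi> has_field_derivative deriv \<phi> (disc_auto a z)) (at (disc_auto a z))"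
      using \<phi>(1) disc_auto_in_disc[OF a z] by (auto intro: holomorphic_derivI)
    then have "((\<lambda>z. \<phi> (disc_auto a z)) has_field_derivative
      deriv \<phi> (disc_auto a z) * (of_real (1 - (cmod a)\<^sup>2) / (1 + cnj a * z)\<^sup>2)) (at z)"
      using DERIV_chain2 disc_auto_has_derivative[OF a z] by blast
    then have "((\<lambda>z. (\<phi> (disc_auto a z) - \<phi> a) / c) has_field_derivative
      (deriv \<phi> (disc_auto a z) * (of_real (1 - (cmod a)\<^sup>2) / (1 + cnj a * z)\<^sup>2) - 0) / c) (at z)"
      by (intro DERIV_cdivide DERIV_diff DERIV_const)
    then have "((\<lambda>z. (\<phi> (disc_auto a z) - \<phi> a) / c) has_field_derivative
      deriv \<phi> (disc_auto a z) * (of_real (1 - (cmod a)\<^sup>2) / (1 + cnj a * z)\<^sup>2) / c) (at z)"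
      by (simp only: diff_0_right)
    then show ?thesis
      by (rule has_field_derivative_transform_within_open[of _ _ _ unit_disc]) (use z \<psi> in auto)
  qed
  have da0: "disc_auto a 0 = a" by (simp add: disc_auto_def)
  have "(deriv \<phi> has_field_derivative deriv (deriv \<phi>) a) (at (disc_auto a 0))"
    using \<phi>(1) a unfolding da0 by (auto intro!: holomorphic_derivI[of _ unit_disc] holomorphic_deriv)
  then have "((\<lambda>z. deriv \<phi> (disc_auto a z)) has_field_derivative
      deriv (deriv \<phi>) a * of_real (1 - (cmod a)\<^sup>2)) (at 0)"
    using DERIV_chain2 disc_auto_has_derivative[OF a, of 0] by fastforce
  then have "((\<lambda>z. deriv \<phi> (disc_auto a z) * (of_real (1 - (cmod a)\<^sup>2) / (1 + cnj a * z)\<^sup>2)) has_field_derivative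
      deriv (deriv \<phi>) a * of_real (1 - (cmod a)\<^sup>2) * of_real (1 - (cmod a)\<^sup>2)
        - deriv \<phi> a * of_real (1 - (cmod a)\<^sup>2) * (2 * cnj a)) (at 0)"
    by (auto intro!: derivative_eq_intros simp: da0 algebra_simps)
  then have "((\<lambda>z. deriv \<phi> (disc_auto a z) * (of_real (1 - (cmod a)\<^sup>2) / (1 + cnj a * z)\<^sup>2) / c) has_field_derivative
      (deriv (deriv \<phi>) a * of_real (1 - (cmod a)\<^sup>2) * of_real (1 - (cmod a)\<^sup>2)
        - deriv \<phi> a * of_real (1 - (cmod a)\<^sup>2) * (2 * cnj a)) / c) (at 0)"
    by (rule DERIV_cdivide)
  then have "(deriv \<psi> has_field_derivative
      (deriv (deriv \<phi>) a * of_real (1 - (cmod a)\<^sup>2) * of_real (1 - (cmod a)\<^sup>2)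
        - deriv \<phi> a * of_real (1 - (cmod a)\<^sup>2) * (2 * cnj a)) / c) (at 0)"
    by (rule has_field_derivative_transform_within_open[of _ _ _ unit_disc]) (use DERIV_imp_deriv[OF d\<psi>] in auto)
  then have "deriv (deriv \<psi>) 0 = (deriv (deriv \<phi>) a * of_real (1 - (cmod a)\<^sup>2) * of_real (1 - (cmod a)\<^sup>2)
        - deriv \<phi> a * of_real (1 - (cmod a)\<^sup>2) * (2 * cnj a)) / c"
    by (rule DERIV_imp_deriv)
  then have "taylor_coeff2 \<psi> = of_real ((1 - (cmod a)\<^sup>2) / 2) * (deriv (deriv \<phi>) a / deriv \<phi> a) - cnj a"
    unfolding taylor_coeff2_def c_def using a2 \<phi>(4)[OF a]
    by (simp add: numeral_2_eq_2 del: of_real_diff) (simp add: field_simps del: of_real_diff)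
  moreover have "ereal (cmod (taylor_coeff2 \<psi>)) \<le> ereal \<gamma>"
    unfolding L(2)[symmetric] family_order_def using \<psi>(1) by (intro SUP_upper)
  ultimately show ?thesis by simp
qed

lemma has_real_derivative_cmod:
  assumes "(u has_vector_derivative u') (at t)" "u t \<noteq> 0"
  shows "((\<lambda>t. cmod (u t)) has_real_derivative Re (u' * cnj (u t)) / cmod (u t)) (at t)"
proof -
  have sq: "((\<lambda>t. (Re (u t))\<^sup>2 + (Im (u t))\<^sup>2) has_real_derivative
      2 * Re (u t) * Re u' + 2 * Im (u t) * Im u') (at t)"
    using DERIV_add[OF DERIV_power[OF has_field_derivative_Re[OF assms(1)], of 2]
                       DERIV_power[OF has_field_derivative_Im[OF assms(1)], of 2]]
    by (simp add: mult.commute mult.left_commute)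
  have "0 < (Re (u t))\<^sup>2 + (Im (u t))\<^sup>2" using assms(2) by (simp add: complex_neq_0)
  from DERIV_chain2[OF DERIV_real_sqrt[OF this] sq]
  have "((\<lambda>t. sqrt ((Re (u t))\<^sup>2 + (Im (u t))\<^sup>2)) has_real_derivative
      inverse (sqrt ((Re (u t))\<^sup>2 + (Im (u t))\<^sup>2)) / 2 * (2 * Re (u t) * Re u' + 2 * Im (u t) * Im u')) (at t)" .
  moreover have "inverse n / 2 * (2 * a * p + 2 * b * q) = (p * a + q * b) / n" for n a b p q :: real
    by (cases "n = 0") (simp_all add: field_simps)
  ultimately have "((\<lambda>t. cmod (u t)) has_real_derivative (Re u' * Re (u t) + Im u' * Im (u t)) / cmod (u t)) (at t)"
    by (simp only: cmod_def)
  then show ?thesis by simp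
qed

text \<open>
  Along a radius the second coefficient bound is a differential inequality for the logarithm of
  \<open>|\<phi>'|\<close>. The bound is \<open>((1 - r) / (1 + r))\<^sup>\<gamma> / (1 - r\<^sup>2)\<close>, written with exponentials because these are
  easier to differentiate.
\<close>

lemma distortion_lower_bound:
  assumes L: "linear_invariant_family L" "family_order L = ereal \<gamma>" "\<phi> \<in> L" and z: "z \<in> unit_disc"
  shows "exp (\<gamma> * (ln (1 - cmod z) - ln (1 + cmod z))) / (1 - (cmod z)\<^sup>2) \<le> cmod (deriv \<phi> z)"
proof -
  note \<phi> = linear_invariant_familyD[OF L(1,3)]
  obtain e where e: "cmod e = 1" "z = of_real (cmod z) * e"
  proof (cases "z = 0")
    case True then show ?thesis using that[of 1] by simp
  next
    case False then show ?thesis by (intro that[of "sgn z"]) (simp_all add: sgn_eq norm_divide)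
  qed
  define r where "r = cmod z"
  have r: "0 \<le> r" "r < 1" using z by (auto simp: r_def)
  define u where "u = (\<lambda>\<rho>::real. deriv \<phi> (of_real \<rho> * e))"
  define \<Phi> where "\<Phi> = (\<lambda>\<rho>. ln (cmod (u \<rho>)) + ln (1 - \<rho>) + ln (1 + \<rho>) - \<gamma> * (ln (1 - \<rho>) - ln (1 + \<rho>)))"
  have "\<Phi> 0 \<le> \<Phi> r"
  proof (rule DERIV_nonneg_imp_nondecreasing[OF r(1)])
    fix \<rho> assume \<rho>: "0 \<le> \<rho>" "\<rho> \<le> r"
    define p where "p = of_real \<rho> * e"
    have cp: "cmod p = \<rho>" using e \<rho> by (simp add: p_def norm_mult)
    then have p: "p \<in> unit_disc" using \<rho> r by simp
    have u0: "u \<rho> \<noteq> 0" using \<phi>(4)[OF p] by (simp add: u_def p_def)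
    have "(deriv \<phi> has_field_derivative deriv (deriv \<phi>) p) (at p)"
      using \<phi>(1) p by (auto intro!: holomorphic_derivI[of _ unit_disc] holomorphic_deriv)
    moreover have "((\<lambda>\<rho>::real. of_real \<rho> * e) has_vector_derivative e) (at \<rho>)"
      by (auto intro!: derivative_eq_intros)
    ultimately have "(deriv \<phi> \<circ> (\<lambda>\<rho>::real. of_real \<rho> * e) has_vector_derivative e * deriv (deriv \<phi>) p) (at \<rho>)"
      unfolding p_def by (rule field_vector_diff_chain_at[rotated])
    then have "(u has_vector_derivative e * deriv (deriv \<phi>) p) (at \<rho>)"
      by (simp only: o_def u_def)
    note n = has_real_derivative_cmod[OF this u0]
    have "cmod (u \<rho>) > 0" using u0 by simp
    from DERIV_chain2[OF DERIV_ln_divide[OF this] n]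
    have d1: "((\<lambda>\<rho>. ln (cmod (u \<rho>))) has_real_derivative
       1 / cmod (u \<rho>) * (Re (e * deriv (deriv \<phi>) p * cnj (u \<rho>)) / cmod (u \<rho>))) (at \<rho>)" .
    have "1 / cmod (u \<rho>) * (Re (e * deriv (deriv \<phi>) p * cnj (u \<rho>)) / cmod (u \<rho>))
       = Re (e * (deriv (deriv \<phi>) p / deriv \<phi> p))"
    proof -
      have "e * (deriv (deriv \<phi>) p / u \<rho>) = e * deriv (deriv \<phi>) p * cnj (u \<rho>) / of_real ((cmod (u \<rho>))\<^sup>2)"
        using u0 unfolding complex_norm_square by simp
      then have "Re (e * (deriv (deriv \<phi>) p / u \<rho>)) = Re (e * deriv (deriv \<phi>) p * cnj (u \<rho>)) / (cmod (u \<rho>))\<^sup>2"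
        by (simp only: Re_divide_of_real)
      then show ?thesis by (simp add: power2_eq_square u_def p_def)
    qed
    note d1 = d1[unfolded this]
    define B where "B = Re (e * (deriv (deriv \<phi>) p / deriv \<phi> p))"
    have d2: "((\<lambda>\<rho>. ln (1 - \<rho>)) has_real_derivative - (1 / (1 - \<rho>))) (at \<rho>)"
      and d3: "((\<lambda>\<rho>. ln (1 + \<rho>)) has_real_derivative 1 / (1 + \<rho>)) (at \<rho>)"
      using \<rho> r by (auto intro!: derivative_eq_intros)
    \<comment> \<open>The derivative of \<open>\<Phi>\<close> is \<open>2 / (1 - \<rho>\<^sup>2)\<close> times a quantity that the second coefficient bound makes nonnegative.\<close>
    have "(\<Phi> has_real_derivative B + - (1 / (1 - \<rho>)) + 1 / (1 + \<rho>) - \<gamma> * (- (1 / (1 - \<rho>)) - 1 / (1 + \<rho>))) (at \<rho>)"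
      unfolding \<Phi>_def B_def by (intro DERIV_add DERIV_diff DERIV_cmult d1 d2 d3)
    then have "(\<Phi> has_real_derivative B - 1 / (1 - \<rho>) + 1 / (1 + \<rho>) + \<gamma> * (1 / (1 - \<rho>) + 1 / (1 + \<rho>))) (at \<rho>)"
      by (rule DERIV_cong) (simp add: algebra_simps)
    moreover have "B - 1 / (1 - \<rho>) + 1 / (1 + \<rho>) + \<gamma> * (1 / (1 - \<rho>) + 1 / (1 + \<rho>)) \<ge> 0"
    proof -
      have "cmod (e * (of_real ((1 - (cmod p)\<^sup>2) / 2) * (deriv (deriv \<phi>) p / deriv \<phi> p) - cnj p)) \<le> \<gamma>"
        using family_second_coefficient_bound[OF L p] e by (simp add: norm_mult)
      also have "e * (of_real ((1 - (cmod p)\<^sup>2) / 2) * (deriv (deriv \<phi>) p / deriv \<phi> p) - cnj p)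
         = of_real ((1 - \<rho>\<^sup>2) / 2) * (e * (deriv (deriv \<phi>) p / deriv \<phi> p)) - of_real \<rho> * (e * cnj e)"
        unfolding cp by (simp add: p_def algebra_simps)
      also have "e * cnj e = 1" using e by (simp add: complex_norm_square[symmetric])
      finally have "- \<gamma> \<le> Re (of_real ((1 - \<rho>\<^sup>2) / 2) * (e * (deriv (deriv \<phi>) p / deriv \<phi> p)) - of_real \<rho> * 1)"
        using complex_Re_le_cmod[of "- (of_real ((1 - \<rho>\<^sup>2) / 2) * (e * (deriv (deriv \<phi>) p / deriv \<phi> p)) - of_real \<rho> * 1)"]
        unfolding norm_minus_cancel uminus_complex.sel by linarith
      moreover have "Re (of_real x * v - of_real \<rho> * 1) = x * Re v - \<rho>" for x v by simp
      ultimately have B: "- \<gamma> \<le> (1 - \<rho>\<^sup>2) / 2 * B - \<rho>" unfolding B_def by metis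
      define D where "D = 1 - \<rho>\<^sup>2"
      have D: "D = (1 - \<rho>) * (1 + \<rho>)" by (simp add: D_def power2_eq_square algebra_simps)
      then have D0: "D > 0" using \<rho> r by simp
      have fr: "1 / (1 - \<rho>) = (1 + \<rho>) / D" "1 / (1 + \<rho>) = (1 - \<rho>) / D"
        using \<rho> r by (auto simp: D)
      have "B - 1 / (1 - \<rho>) + 1 / (1 + \<rho>) + \<gamma> * (1 / (1 - \<rho>) + 1 / (1 + \<rho>))
         = 2 * (D / 2 * B - \<rho> + \<gamma>) / D"
        unfolding fr using D0 by (simp add: field_simps)
      moreover have "2 * (D / 2 * B - \<rho> + \<gamma>) / D \<ge> 0"
        using B D0 by (intro divide_nonneg_pos) (auto simp: D_def)
      ultimately show ?thesis by simp
    qed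
    ultimately show "\<exists>y. (\<Phi> has_real_derivative y) (at \<rho>) \<and> 0 \<le> y" by blast
  qed
  then have "0 \<le> \<Phi> r" using \<phi>(3) by (simp add: \<Phi>_def u_def)
  moreover have "u r = deriv \<phi> z" using e(2) by (simp add: u_def r_def)
  ultimately have "\<gamma> * (ln (1 - r) - ln (1 + r)) - (ln (1 - r) + ln (1 + r)) \<le> ln (cmod (deriv \<phi> z))"
    by (simp add: \<Phi>_def)
  then have "exp (\<gamma> * (ln (1 - r) - ln (1 + r)) - (ln (1 - r) + ln (1 + r))) \<le> cmod (deriv \<phi> z)"
    using \<phi>(4)[OF z] by (subst ln_ge_iff[symmetric]) auto
  also have "exp (\<gamma> * (ln (1 - r) - ln (1 + r)) - (ln (1 - r) + ln (1 + r)))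
     = exp (\<gamma> * (ln (1 - r) - ln (1 + r))) / ((1 - r) * (1 + r))"
    using r by (simp add: exp_diff exp_add)
  finally show ?thesis by (simp add: r_def power2_eq_square algebra_simps)
qed

text \<open>
  On the circle about 0 through \<open>z\<close>, let \<open>z0\<close> be a point where \<open>|\<psi>|\<close> is smallest. By univalence the segment from 0 to \<open>\<psi> z0\<close> is
  the image of a curve in the disc that joins the origin to the circle. The length of the segment is
  therefore at least the integral of \<open>E'\<close> over the moduli that the curve passes through.
\<close>

lemma univalent_growth_from_distortion:
  fixes E E' :: "real \<Rightarrow> real"
  assumes hol: "\<psi> holomorphic_on unit_disc" and inj: "inj_on \<psi> unit_disc" and \<psi>0: "\<psi> 0 = 0"
    and E0: "E 0 = 0" and E: "\<And>\<rho>. 0 \<le> \<rho> \<Longrightarrow> \<rho> < 1 \<Longrightarrow> (E has_real_derivative E' \<rho>) (at \<rho>)"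
    and E'0: "\<And>\<rho>. 0 \<le> \<rho> \<Longrightarrow> \<rho> < 1 \<Longrightarrow> 0 \<le> E' \<rho>"
    and dist: "\<And>z. z \<in> unit_disc \<Longrightarrow> E' (cmod z) \<le> cmod (deriv \<psi> z)"
    and z: "z \<in> unit_disc"
  shows "E (cmod z) \<le> cmod (\<psi> z)"
proof (cases "z = 0")
  case True then show ?thesis using E0 by simp
next
  case False
  define r where "r = cmod z"
  have r: "0 < r" "r < 1" using z False by (auto simp: r_def)
  have cont: "continuous_on unit_disc \<psi>" using hol by (rule holomorphic_on_imp_continuous_on)
  have "continuous_on (sphere 0 r) (\<lambda>z. cmod (\<psi> z))"
    using r by (intro continuous_intros continuous_on_subset[OF cont]) auto
  moreover have "z \<in> sphere 0 r" by (simp add: r_def)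
  ultimately obtain z0 where z0: "z0 \<in> sphere 0 r" "\<And>y. y \<in> sphere 0 r \<Longrightarrow> cmod (\<psi> z0) \<le> cmod (\<psi> y)"
    using continuous_attains_inf[of "sphere 0 r" "\<lambda>z. cmod (\<psi> z)"] by auto
  define d where "d = cmod (\<psi> z0)"
  have z0D: "z0 \<in> unit_disc" "z0 \<noteq> 0" using z0(1) r by auto
  then have d: "d > 0" using inj \<psi>0 unfolding d_def
    by (metis centre_in_ball inj_onD norm_le_zero_iff not_less zero_less_one)
  have sub: "ball 0 d \<subseteq> \<psi> ` ball 0 r"
  proof -
    have "ball (\<psi> 0) d \<subseteq> \<psi> ` ball 0 r"
    proof (rule ball_subset_open_map_image)
      show "continuous_on (closure (ball 0 r)) \<psi>" using r by (intro continuous_on_subset[OF cont]) auto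
      show "open (\<psi> ` interior (ball 0 r))"
        using r by (auto intro!: open_mapping_thm3 holomorphic_on_subset[OF hol] inj_on_subset[OF inj])
    qed (use r z0 d \<psi>0 in \<open>auto simp: d_def\<close>)
    then show ?thesis using \<psi>0 by simp
  qed
  obtain g where g: "g holomorphic_on \<psi> ` unit_disc"
      "\<And>z. z \<in> unit_disc \<Longrightarrow> deriv \<psi> z * deriv g (\<psi> z) = 1" "\<And>z. z \<in> unit_disc \<Longrightarrow> g (\<psi> z) = z"
    using holomorphic_has_inverse[OF hol open_ball inj] by metis
  have opn: "open (\<psi> ` unit_disc)" by (intro open_mapping_thm3 hol inj open_ball)
  define \<zeta> where "\<zeta> = (\<lambda>s::real. of_real s * \<psi> z0)"
  have im: "\<zeta> s \<in> \<psi> ` unit_disc" if "0 \<le> s" "s \<le> 1" for s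
  proof (cases "s = 1")
    case True then show ?thesis using z0D by (auto simp: \<zeta>_def)
  next
    case False
    then have "cmod (\<zeta> s) < d" using that d by (simp add: \<zeta>_def norm_mult d_def[symmetric])
    then have "\<zeta> s \<in> \<psi> ` ball 0 r" using sub by auto
    then show ?thesis using r by force
  qed
  have gin: "g (\<zeta> s) \<in> unit_disc" "\<psi> (g (\<zeta> s)) = \<zeta> s" if "0 \<le> s" "s \<le> 1" for s
    using im[OF that] g(3) by auto
  define h where "h = (\<lambda>s. s * d - E (cmod (g (\<zeta> s))))"
  have "h 0 \<le> h 1"
  proof (rule DERIV_nonneg_imp_increasing_open[of 0 1 h])
    have contE: "continuous_on {0..<1} E"
      using E by (intro DERIV_continuous_on) (auto intro: has_field_derivative_at_within)
    show "continuous_on {0..1} h"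
      unfolding h_def
      by (intro continuous_intros continuous_on_compose2[OF contE] continuous_on_compose2[OF holomorphic_on_imp_continuous_on[OF g(1)]])
         (use im gin in \<open>auto simp: \<zeta>_def intro!: continuous_intros\<close>)
    fix s :: real assume s: "0 < s" "s < 1"
    define p where "p = g (\<zeta> s)"
    have p: "p \<in> unit_disc" "\<psi> p = \<zeta> s" using gin s by (auto simp: p_def)
    have "\<zeta> s \<noteq> 0" using s d by (simp add: \<zeta>_def d_def)
    then have p0: "p \<noteq> 0" using p \<psi>0 by auto
    have "(\<zeta> has_vector_derivative \<psi> z0) (at s)"
      unfolding \<zeta>_def by (auto intro!: derivative_eq_intros)
    moreover have "(g has_field_derivative deriv g (\<zeta> s)) (at (\<zeta> s))"
      using im s by (intro holomorphic_derivI[OF g(1) opn]) auto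
    ultimately have "((\<lambda>s. g (\<zeta> s)) has_vector_derivative \<psi> z0 * deriv g (\<zeta> s)) (at s)"
      using field_vector_diff_chain_at[of \<zeta> "\<psi> z0" s g] by (simp only: o_def)
    then have dn: "((\<lambda>s. cmod (g (\<zeta> s))) has_real_derivative Re (\<psi> z0 * deriv g (\<zeta> s) * cnj p) / cmod p) (at s)"
      using has_real_derivative_cmod p0 unfolding p_def by blast
    have "(E has_real_derivative E' (cmod p)) (at (cmod (g (\<zeta> s))))"
      using E[of "cmod p"] p by (simp add: p_def)
    from DERIV_chain2[OF this dn]
    have "(h has_real_derivative d - E' (cmod p) * (Re (\<psi> z0 * deriv g (\<zeta> s) * cnj p) / cmod p)) (at s)"
      unfolding h_def by (auto intro!: derivative_eq_intros)
    moreover have "E' (cmod p) * (Re (\<psi> z0 * deriv g (\<zeta> s) * cnj p) / cmod p) \<le> d"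
    proof -
      have "Re (\<psi> z0 * deriv g (\<zeta> s) * cnj p) \<le> cmod (deriv g (\<zeta> s)) * d * cmod p"
        using complex_Re_le_cmod[of "\<psi> z0 * deriv g (\<zeta> s) * cnj p"]
        by (simp only: norm_mult complex_mod_cnj d_def mult_ac)
      then have "Re (\<psi> z0 * deriv g (\<zeta> s) * cnj p) / cmod p \<le> cmod (deriv g (\<zeta> s)) * d"
        using p0 by (simp add: field_simps)
      then have "E' (cmod p) * (Re (\<psi> z0 * deriv g (\<zeta> s) * cnj p) / cmod p)
         \<le> E' (cmod p) * (cmod (deriv g (\<zeta> s)) * d)"
        using E'0 p by (intro mult_left_mono) auto
      also have "\<dots> \<le> cmod (deriv \<psi> p) * (cmod (deriv g (\<zeta> s)) * d)"
        using dist[OF p(1)] d by (intro mult_right_mono) auto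
      also have "\<dots> = cmod (deriv \<psi> p * deriv g (\<psi> p)) * d" by (simp add: norm_mult p(2))
      also have "\<dots> = d" using g(2)[OF p(1)] by simp
      finally show ?thesis .
    qed
    ultimately show "\<exists>y. (h has_real_derivative y) (at s) \<and> 0 \<le> y"
      by (metis diff_ge_0_iff_ge)
  qed simp
  moreover have "g (\<zeta> 1) = z0" using g(3)[OF z0D(1)] by (simp add: \<zeta>_def)
  moreover have "g (\<zeta> 0) = 0" using g(3)[of 0] \<psi>0 by (simp add: \<zeta>_def)
  ultimately have "E r \<le> d" using E0 z0(1) by (simp add: h_def)
  also have "d \<le> cmod (\<psi> z)" unfolding d_def using z0(2)[of z] by (simp add: r_def)
  finally show ?thesis by (simp add: r_def)
qed

text \<open>
  Integrating the distortion bound gives \<open>(1 - ((1 - r) / (1 + r))\<^sup>\<gamma>) / (2 \<gamma>)\<close>. Replacing the exponent by 1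
  decreases this, as \<open>\<gamma> \<ge> 1\<close>, and leaves a rational bound.
\<close>

lemma univalent_growth_lower_bound:
  assumes L: "linear_invariant_family L" "family_order L = ereal \<gamma>" "\<phi> \<in> L" and \<gamma>: "1 \<le> \<gamma>"
    and inj: "inj_on \<phi> unit_disc" and z: "z \<in> unit_disc"
  shows "cmod z / (\<gamma> * (1 + cmod z)) \<le> cmod (\<phi> z)"
proof -
  note \<phi> = linear_invariant_familyD[OF L(1,3)]
  define E where "E = (\<lambda>\<rho>. (1 - exp (\<gamma> * (ln (1 - \<rho>) - ln (1 + \<rho>)))) / (2 * \<gamma>))"
  define r where "r = cmod z"
  have r: "0 \<le> r" "r < 1" using z by (auto simp: r_def)
  have "E r \<le> cmod (\<phi> z)"
    unfolding r_def
  proof (rule univalent_growth_from_distortion[OF \<phi>(1) inj \<phi>(2), of E "\<lambda>\<rho>. exp (\<gamma> * (ln (1 - \<rho>) - ln (1 + \<rho>))) / (1 - \<rho>\<^sup>2)"])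
    show "E 0 = 0" by (simp add: E_def)
    show "(E has_real_derivative exp (\<gamma> * (ln (1 - \<rho>) - ln (1 + \<rho>))) / (1 - \<rho>\<^sup>2)) (at \<rho>)"
      if "0 \<le> \<rho>" "\<rho> < 1" for \<rho>
    proof -
      have *: "1 / (1 - \<rho>) + 1 / (1 + \<rho>) = 2 / (1 - \<rho>\<^sup>2)"
      proof -
        have "1 - \<rho>\<^sup>2 = (1 - \<rho>) * (1 + \<rho>)" by (simp add: power2_eq_square algebra_simps)
        then show ?thesis using that by (simp add: divide_simps)
      qed
      have "(E has_real_derivative
         - (exp (\<gamma> * (ln (1 - \<rho>) - ln (1 + \<rho>))) * (\<gamma> * (- (1 / (1 - \<rho>)) - 1 / (1 + \<rho>)))) / (2 * \<gamma>)) (at \<rho>)"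
        unfolding E_def using that \<gamma> by (auto intro!: derivative_eq_intros)
      also have "- (exp (\<gamma> * (ln (1 - \<rho>) - ln (1 + \<rho>))) * (\<gamma> * (- (1 / (1 - \<rho>)) - 1 / (1 + \<rho>)))) / (2 * \<gamma>)
         = exp (\<gamma> * (ln (1 - \<rho>) - ln (1 + \<rho>))) * (1 / (1 - \<rho>) + 1 / (1 + \<rho>)) / 2"
        using \<gamma> by (simp add: field_simps)
      also have "\<dots> = exp (\<gamma> * (ln (1 - \<rho>) - ln (1 + \<rho>))) / (1 - \<rho>\<^sup>2)"
      proof -
        have "x * (2 / y) / 2 = x / y" for x y :: real by simp
        then show ?thesis unfolding * by blast
      qed
      finally show ?thesis .
    qed
    show "0 \<le> exp (\<gamma> * (ln (1 - \<rho>) - ln (1 + \<rho>))) / (1 - \<rho>\<^sup>2)" if "0 \<le> \<rho>" "\<rho> < 1" for \<rho> :: real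
      using that by (simp add: power_le_one)
  qed (use distortion_lower_bound[OF L] z in auto)
  moreover have "cmod z / (\<gamma> * (1 + cmod z)) \<le> E r"
  proof -
    have "ln (1 - r) - ln (1 + r) \<le> 0" using r by simp
    then have "(\<gamma> - 1) * (ln (1 - r) - ln (1 + r)) \<le> 0" using \<gamma> by (simp add: mult_nonneg_nonpos)
    then have "\<gamma> * (ln (1 - r) - ln (1 + r)) \<le> ln (1 - r) - ln (1 + r)" by (simp add: algebra_simps)
    then have "exp (\<gamma> * (ln (1 - r) - ln (1 + r))) \<le> (1 - r) / (1 + r)"
      using r by (metis add_pos_nonneg diff_gt_0_iff_gt exp_diff exp_le_cancel_iff exp_ln zero_less_one)
    then have "(1 - (1 - r) / (1 + r)) / (2 * \<gamma>) \<le> E r"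
      unfolding E_def using \<gamma> by (intro divide_right_mono) auto
    moreover have "(1 - (1 - r) / (1 + r)) / (2 * \<gamma>) = r / (\<gamma> * (1 + r))"
    proof -
      have "1 - (1 - r) / (1 + r) = 2 * (r / (1 + r))" using r by (simp add: field_simps)
      then show ?thesis by simp
    qed
    ultimately show ?thesis by (simp add: r_def)
  qed
  ultimately show ?thesis by simp
qed

text \<open>
  The Koebe transform at \<open>a\<close> takes at \<open>- a\<close> the value \<open>- \<phi> a / ((1 - |a|\<^sup>2) \<phi>' a)\<close>, to which the growth
  bound applies.
\<close>

lemma univalent_log_derivative_bound:
  assumes L: "linear_invariant_family L" "family_order L = ereal \<gamma>" "\<phi> \<in> L" and \<gamma>: "1 \<le> \<gamma>"
    and inj: "inj_on \<phi> unit_disc" and a: "a \<in> unit_disc"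
  shows "(1 - (cmod a)\<^sup>2) * cmod (a * deriv \<phi> a / \<phi> a) \<le> \<gamma> * (1 + cmod a)"
proof (cases "a = 0")
  case True then show ?thesis using \<gamma> by simp
next
  case False
  note \<phi> = linear_invariant_familyD[OF L(1,3)]
  define c where "c = of_real (1 - (cmod a)\<^sup>2) * deriv \<phi> a"
  have a1: "cmod a < 1" using a by simp
  then have a2: "(cmod a)\<^sup>2 < 1" by (simp add: power_less_one_iff)
  have c: "cmod c = (1 - (cmod a)\<^sup>2) * cmod (deriv \<phi> a)"
    unfolding c_def norm_mult norm_of_real using a2 by simp
  have c0: "c \<noteq> 0" using c a2 \<phi>(4)[OF a] by auto
  obtain \<psi> where \<psi>: "\<psi> \<in> L" "\<And>z. z \<in> unit_disc \<Longrightarrow> \<psi> z = (\<phi> (disc_auto a z) - \<phi> a) / c"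
    using L a unfolding linear_invariant_family_def c_def by blast
  have "inj_on \<psi> unit_disc"
  proof (rule inj_onI)
    fix x y assume xy: "x \<in> unit_disc" "y \<in> unit_disc" "\<psi> x = \<psi> y"
    then have "\<phi> (disc_auto a x) = \<phi> (disc_auto a y)" using \<psi>(2) c0 by simp
    then have "disc_auto a x = disc_auto a y" using inj_onD[OF inj] disc_auto_in_disc[OF a] xy by blast
    then show "x = y" using inj_onD[OF disc_auto_inj[OF a]] xy by blast
  qed
  then have "cmod a / (\<gamma> * (1 + cmod a)) \<le> cmod (\<psi> (- a))"
    using univalent_growth_lower_bound[OF L(1,2) \<psi>(1) \<gamma>, of "- a"] a by simp
  also have "\<psi> (- a) = - \<phi> a / c" using \<psi>(2)[of "- a"] a \<phi>(2) by (simp add: disc_auto_def)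
  finally have "cmod a / (\<gamma> * (1 + cmod a)) \<le> cmod (\<phi> a) / cmod c" by (simp add: norm_divide)
  moreover have "cmod (\<phi> a) > 0"
    using inj_onD[OF inj, of a 0] a False \<phi>(2) by auto
  ultimately have "cmod a * cmod c / cmod (\<phi> a) \<le> \<gamma> * (1 + cmod a)"
    using \<gamma> c0 by (simp add: field_simps add_pos_nonneg)
  then show ?thesis unfolding c by (simp add: norm_mult norm_divide mult_ac)
qed

section \<open>The Schwarz-Pick lemma and the hyperbolic norm\<close>

lemma sup_norm_bounds:
  assumes w: "\<And>z. z \<in> unit_disc \<Longrightarrow> cmod (w z) < 1"
  shows "z \<in> unit_disc \<Longrightarrow> cmod (w z) \<le> sup_norm w" "sup_norm w \<le> 1" "0 \<le> sup_norm w"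
proof -
  have bdd: "bdd_above ((\<lambda>z. cmod (w z)) ` unit_disc)"
    using w by (intro bdd_aboveI[of _ 1]) (auto intro: less_imp_le)
  show le: "cmod (w z) \<le> sup_norm w" if "z \<in> unit_disc" for z
    unfolding sup_norm_def using that bdd by (intro cSUP_upper)
  show "sup_norm w \<le> 1"
    unfolding sup_norm_def using w by (intro cSUP_least) (auto intro: less_imp_le)
  show "0 \<le> sup_norm w" using order_trans[OF norm_ge_zero le[of 0]] by simp
qed

text \<open>
  The Schwarz lemma at the origin, transported by automorphisms of the disc on both sides.
\<close>

lemma schwarz_pick:
  assumes hol: "w holomorphic_on unit_disc" and w: "\<And>z. z \<in> unit_disc \<Longrightarrow> cmod (w z) < 1"
    and z: "z \<in> unit_disc"
  shows "cmod (deriv w z) * (1 - (cmod z)\<^sup>2) \<le> 1 - (cmod (w z))\<^sup>2"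
proof -
  define A B where "A = Moebius_function 0 (- z)" and "B = Moebius_function 0 (w z)"
  define F where "F = (\<lambda>x. B (w (A x)))"
  have z1: "cmod z < 1" and w1: "cmod (w z) < 1" using z w by auto
  have Ain: "A x \<in> unit_disc" if "x \<in> unit_disc" for x
    using that z1 by (simp add: A_def Moebius_function_norm_lt_1)
  have A0: "A 0 = z" by (simp add: A_def Moebius_function_def)
  have holA: "A holomorphic_on unit_disc" and holB: "B holomorphic_on unit_disc"
    using z1 w1 by (auto simp: A_def B_def intro!: Moebius_function_holomorphic)
  have "(w \<circ> A) holomorphic_on unit_disc"
    using Ain by (intro holomorphic_on_compose_gen[OF holA hol]) auto
  then have "(B \<circ> (w \<circ> A)) holomorphic_on unit_disc"
    using Ain w by (intro holomorphic_on_compose_gen[OF _ holB]) (auto simp: image_subset_iff)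
  then have holF: "F holomorphic_on unit_disc" by (simp add: F_def o_def)
  have F0: "F 0 = 0" by (simp add: F_def A0 B_def Moebius_function_def)
  have "cmod (deriv F 0) \<le> 1"
    using holF F0 Ain w w1 by (intro Schwarz_Lemma(2)[of F 0]) (auto simp: F_def B_def Moebius_function_norm_lt_1)
  moreover have "deriv F 0 = 1 / of_real (1 - (cmod (w z))\<^sup>2) * (deriv w z * of_real (1 - (cmod z)\<^sup>2))"
  proof -
    have "(A has_field_derivative of_real (1 - (cmod z)\<^sup>2)) (at 0)"
      unfolding A_def Moebius_function_def[abs_def]
      using complex_norm_square[of z] by (auto intro!: derivative_eq_intros simp: power2_eq_square)
    moreover have "(w has_field_derivative deriv w z) (at (A 0))"
      unfolding A0 using hol z by (auto intro: holomorphic_derivI)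
    ultimately have wA: "((\<lambda>x. w (A x)) has_field_derivative deriv w z * of_real (1 - (cmod z)\<^sup>2)) (at 0)"
      by (intro DERIV_chain2)
    have w2: "(cmod (w z))\<^sup>2 < 1" using w1 by (simp add: power_less_one_iff)
    define d where "d = complex_of_real (1 - (cmod (w z))\<^sup>2)"
    have d: "d \<noteq> 0" using w2 unfolding d_def of_real_eq_0_iff by simp
    have d': "1 - cnj (w z) * w z = d" using complex_norm_square[of "w z"] by (simp add: d_def mult.commute)
    have "(B has_field_derivative 1 / d) (at (w (A 0)))"
      unfolding A0 B_def Moebius_function_def[abs_def]
      using d by (auto intro!: derivative_eq_intros simp: d')
    from DERIV_chain2[OF this wA] show ?thesis
      unfolding F_def d_def by (rule DERIV_imp_deriv)
  qed
  moreover have "cmod (1 / of_real (1 - (cmod (w z))\<^sup>2) * (deriv w z * of_real (1 - (cmod z)\<^sup>2)))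
     = cmod (deriv w z) * (1 - (cmod z)\<^sup>2) / (1 - (cmod (w z))\<^sup>2)"
    using z1 w1 by (simp only: norm_mult norm_divide norm_of_real norm_one) (simp add: power_le_one)
  ultimately have "cmod (deriv w z) * (1 - (cmod z)\<^sup>2) / (1 - (cmod (w z))\<^sup>2) \<le> 1" by simp
  then show ?thesis using w1 by (simp add: power_less_one_iff field_simps)
qed

text \<open>
  The Schwarz-Pick lemma for \<open>w / M\<close>, where \<open>M\<close> exceeds the supremum norm because \<open>w\<close> may be a constant of
  modulus \<open>\<parallel>w\<parallel>\<close> or zero; then \<open>M\<close> tends to the norm.
\<close>

lemma schwarz_pick_sup_norm:
  assumes hol: "w holomorphic_on unit_disc" and w: "\<And>z. z \<in> unit_disc \<Longrightarrow> cmod (w z) < 1"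
    and z: "z \<in> unit_disc"
  shows "sup_norm w * (cmod (deriv w z) * (1 - (cmod z)\<^sup>2)) \<le> (sup_norm w)\<^sup>2 - (cmod (w z))\<^sup>2"
proof (rule field_le_epsilon)
  define m where "m = sup_norm w"
  define W where "W = cmod (deriv w z) * (1 - (cmod z)\<^sup>2)"
  have m: "0 \<le> m" "m \<le> 1" "\<And>z. z \<in> unit_disc \<Longrightarrow> cmod (w z) \<le> m"
    using sup_norm_bounds[OF w] by (auto simp: m_def)
  have W0: "0 \<le> W" using z by (simp add: W_def power_le_one)
  fix e :: real assume e: "0 < e"
  define M where "M = m + min 1 (e / 3)"
  have M: "m < M" "M > 0" using m e by (auto simp: M_def)
  have "cmod (deriv (\<lambda>x. w x / of_real M) z) * (1 - (cmod z)\<^sup>2) \<le> 1 - (cmod (w z / of_real M))\<^sup>2"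
  proof (rule schwarz_pick[OF _ _ z])
    show "(\<lambda>x. w x / of_real M) holomorphic_on unit_disc" using M by (intro holomorphic_intros hol) auto
    show "cmod (w x / of_real M) < 1" if "x \<in> unit_disc" for x
      using m(3)[OF that] M by (simp add: norm_divide)
  qed
  also have "deriv (\<lambda>x. w x / of_real M) z = deriv w z / of_real M"
    using hol z by (intro DERIV_imp_deriv DERIV_cdivide) (auto intro: holomorphic_derivI)
  finally have "W / M \<le> 1 - (cmod (w z))\<^sup>2 / M\<^sup>2"
    using M by (simp add: W_def norm_divide power_divide)
  then have "M\<^sup>2 * (W / M) \<le> M\<^sup>2 * (1 - (cmod (w z))\<^sup>2 / M\<^sup>2)" by (intro mult_left_mono) auto
  then have "M * W \<le> M\<^sup>2 - (cmod (w z))\<^sup>2" using M by (simp add: power2_eq_square algebra_simps)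
  moreover have "m * W \<le> M * W" using M W0 by (intro mult_right_mono) auto
  moreover have "M\<^sup>2 \<le> m\<^sup>2 + e"
  proof -
    define d where "d = min 1 (e / 3)"
    have d: "0 \<le> d" "d \<le> 1" "3 * d \<le> e" using e by (auto simp: d_def)
    have "M\<^sup>2 = m\<^sup>2 + (2 * m + d) * d" by (simp add: M_def d_def power2_eq_square algebra_simps)
    also have "(2 * m + d) * d \<le> 3 * d" using m d by (intro mult_right_mono) auto
    finally show ?thesis using d by simp
  qed
  ultimately show "sup_norm w * (cmod (deriv w z) * (1 - (cmod z)\<^sup>2)) \<le> (sup_norm w)\<^sup>2 - (cmod (w z))\<^sup>2 + e"
    unfolding m_def W_def by linarith
qed

lemma hyp_norm_bounds:
  assumes hol: "w holomorphic_on unit_disc" and w: "\<And>z. z \<in> unit_disc \<Longrightarrow> cmod (w z) < 1"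
  shows "z \<in> unit_disc \<Longrightarrow> cmod (deriv w z) * (1 - (cmod z)\<^sup>2) \<le> hyp_norm w * (1 - (cmod (w z))\<^sup>2)"
    "0 \<le> hyp_norm w" "hyp_norm w \<le> sup_norm w"
proof -
  have pos: "0 < 1 - (cmod (w z))\<^sup>2" if "z \<in> unit_disc" for z
    using w[OF that] by (simp add: power_less_one_iff)
  define h where "h = (\<lambda>z. cmod (deriv w z) * (1 - (cmod z)\<^sup>2) / (1 - (cmod (w z))\<^sup>2))"
  have hn: "hyp_norm w = (SUP z\<in>unit_disc. h z)" by (simp add: hyp_norm_def h_def)
  have hm: "h z \<le> sup_norm w" if z: "z \<in> unit_disc" for z
  proof -
    define m y W where "m = sup_norm w" and "y = cmod (w z)" and "W = cmod (deriv w z) * (1 - (cmod z)\<^sup>2)"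
    have m: "0 \<le> m" "m \<le> 1" "y \<le> m" "0 \<le> y" using sup_norm_bounds[OF w] z by (auto simp: m_def y_def)
    have mW: "m * W \<le> m\<^sup>2 - y\<^sup>2" using schwarz_pick_sup_norm[OF hol w z] by (simp add: m_def y_def W_def)
    have p: "0 < 1 - y\<^sup>2" using pos[OF z] by (simp add: y_def)
    have "W \<le> m * (1 - y\<^sup>2)"
    proof (cases "m = 0")
      case True
      then have "w x = 0" if "x \<in> unit_disc" for x using sup_norm_bounds(1)[of w x] w that by (simp add: m_def)
      then have "(w has_field_derivative 0) (at z)"
        using z by (intro has_field_derivative_transform_within_open[of "\<lambda>_. 0" 0 z unit_disc w]) auto
      then show ?thesis using True by (simp add: W_def DERIV_imp_deriv)
    next
      case False
      have "m\<^sup>2 * y\<^sup>2 \<le> 1 * y\<^sup>2" using m by (intro mult_right_mono) (auto simp: power_le_one)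
      then have "m * W \<le> m * (m * (1 - y\<^sup>2))" using mW by (simp add: power2_eq_square algebra_simps)
      then show ?thesis using False m by simp
    qed
    then show ?thesis using p by (simp add: h_def m_def y_def W_def pos_divide_le_eq)
  qed
  have bdd: "bdd_above (h ` unit_disc)" using hm by (intro bdd_aboveI[of _ "sup_norm w"]) auto
  have le: "h z \<le> hyp_norm w" if "z \<in> unit_disc" for z
    unfolding hn using that bdd by (intro cSUP_upper)
  show "cmod (deriv w z) * (1 - (cmod z)\<^sup>2) \<le> hyp_norm w * (1 - (cmod (w z))\<^sup>2)" if "z \<in> unit_disc" for z
    using le[OF that] pos[OF that] by (simp add: h_def pos_divide_le_eq)
  have "0 \<le> h 0" using pos[of 0] by (simp add: h_def)
  then show "0 \<le> hyp_norm w" using le[of 0] by simp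
  show "hyp_norm w \<le> sup_norm w" unfolding hn using hm by (intro cSUP_least) auto
qed

section \<open>Logarithm of the shear factor\<close>

text \<open>
  Compared along the segment from 0 to \<open>x\<close> with the function \<open>s n / (1 - s n / 2)\<close>; the comparison of
  derivatives is \<open>1 - u \<le> exp (- u)\<close> at \<open>u = s n / 2\<close>.
\<close>

lemma exp_minus_one_bound:
  fixes x :: complex
  assumes "cmod x < 2"
  shows "cmod (exp x - 1) \<le> cmod x / (1 - cmod x / 2)"
proof -
  define n where "n = cmod x"
  have n: "0 \<le> n" "n < 2" using assms by (auto simp: n_def)
  have pos: "1 - s * n / 2 > 0" if "0 \<le> s" "s \<le> 1" for s
    using mult_left_le_one_le[of n s] n that by simp
  have "cmod (exp (of_real 1 * x) - exp (of_real 0 * x)) \<le> 1 * n / (1 - 1 * n / 2) - 0 * n / (1 - 0 * n / 2)"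
  proof (rule differentiable_bound_general[of 0 1 "\<lambda>s. exp (of_real s * x)" "\<lambda>s. s * n / (1 - s * n / 2)"
        "\<lambda>s. x * exp (of_real s * x)" "\<lambda>s. n / (1 - s * n / 2)\<^sup>2"])
    show "continuous_on {0..1} (\<lambda>s. exp (complex_of_real s * x))" by (intro continuous_intros)
    show "continuous_on {0..1} (\<lambda>s. s * n / (1 - s * n / 2))"
      by (intro continuous_intros ballI less_imp_neq[THEN not_sym] pos) auto
    fix s :: real assume s: "0 < s" "s < 1"
    have "((\<lambda>s. exp (s * x)) has_field_derivative x * exp (of_real s * x)) (at (of_real s))"
      by (auto intro!: derivative_eq_intros)
    then show "((\<lambda>s. exp (complex_of_real s * x)) has_vector_derivative x * exp (of_real s * x)) (at s)"
      by (rule has_vector_derivative_real_field)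
    have p: "1 - s * n / 2 > 0" using pos s by simp
    have "((\<lambda>s. s * n / (1 - s * n / 2)) has_real_derivative n / (1 - s * n / 2)\<^sup>2) (at s)"
      using p by (auto intro!: derivative_eq_intros simp: power2_eq_square field_simps)
    then show "((\<lambda>s. s * n / (1 - s * n / 2)) has_vector_derivative n / (1 - s * n / 2)\<^sup>2) (at s)"
      by (simp add: has_real_derivative_iff_has_vector_derivative)
    have "Re (of_real s * x) \<le> s * n" using s complex_Re_le_cmod[of x] by (simp add: n_def mult_left_mono)
    then have "cmod (exp (of_real s * x)) \<le> exp (s * n)" by simp
    also have "exp (s * n) = 1 / (exp (- (s * n / 2)))\<^sup>2"
      by (simp add: power2_eq_square flip: exp_add) (simp add: exp_minus field_simps)
    also have "\<dots> \<le> 1 / (1 - s * n / 2)\<^sup>2"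
      using exp_ge_add_one_self[of "- (s * n / 2)"] p by (intro divide_left_mono power_mono mult_pos_pos) auto
    finally have "n * cmod (exp (of_real s * x)) \<le> n * (1 / (1 - s * n / 2)\<^sup>2)" using n by (intro mult_left_mono)
    then show "cmod (x * exp (of_real s * x)) \<le> n / (1 - s * n / 2)\<^sup>2" by (simp add: norm_mult n_def)
  qed simp
  then show ?thesis by (simp add: n_def)
qed

definition shear_log :: "complex \<Rightarrow> complex \<Rightarrow> complex" where
  "shear_log \<mu> \<omega> = Ln (1 + \<mu> * \<omega>) - Ln (1 - \<omega>)"

lemma one_plus_in_right_half_plane:
  assumes "cmod x < 1"
  shows "1 + x \<notin> \<real>\<^sub>\<le>\<^sub>0" "1 + x \<noteq> 0"
proof -
  have "- Re x \<le> cmod x" using complex_Re_le_cmod[of "- x"] by simp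
  then have "Re (1 + x) > 0" using assms by simp
  then show "1 + x \<notin> \<real>\<^sub>\<le>\<^sub>0" by (auto simp: complex_nonpos_Reals_iff)
  show "1 + x \<noteq> 0" using \<open>Re (1 + x) > 0\<close> by (metis less_irrefl zero_complex.sel(1))
qed

lemma exp_shear_log:
  assumes "cmod \<mu> = 1" "cmod \<omega> < 1"
  shows "exp (shear_log \<mu> \<omega>) = (1 + \<mu> * \<omega>) / (1 - \<omega>)"
  using one_plus_in_right_half_plane(2)[of "\<mu> * \<omega>"] one_plus_in_right_half_plane(2)[of "- \<omega>"] assms
  by (simp add: shear_log_def exp_diff norm_mult)

lemma shear_log_has_derivative:
  assumes "cmod \<mu> = 1" "cmod \<omega> < 1"
  shows "(shear_log \<mu> has_field_derivative \<mu> / (1 + \<mu> * \<omega>) + 1 / (1 - \<omega>)) (at \<omega>)"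
  unfolding shear_log_def[abs_def]
  using one_plus_in_right_half_plane[of "\<mu> * \<omega>"] one_plus_in_right_half_plane[of "- \<omega>"] assms
  by (auto intro!: derivative_eq_intros simp: norm_mult divide_inverse)

text \<open>
  For \<open>|\<mu>| = 1\<close> both summands lie at distance \<open>1 / (1 - |\<omega>|\<^sup>2)\<close> from \<open>- cnj \<omega> / (1 - |\<omega>|\<^sup>2)\<close> and its negative
  respectively.
\<close>

lemma shear_log_derivative_bound:
  assumes \<mu>: "cmod \<mu> = 1" and \<omega>: "cmod \<omega> < 1"
  shows "cmod (\<mu> / (1 + \<mu> * \<omega>) + 1 / (1 - \<omega>)) \<le> 2 / (1 - (cmod \<omega>)\<^sup>2)"
proof -
  define d where "d = complex_of_real (1 - (cmod \<omega>)\<^sup>2)"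
  have d': "0 < 1 - (cmod \<omega>)\<^sup>2" using \<omega> by (simp add: power_less_one_iff)
  then have d0: "d \<noteq> 0" unfolding d_def of_real_eq_0_iff by simp
  have cd: "cmod d = 1 - (cmod \<omega>)\<^sup>2" unfolding d_def norm_of_real using d' by simp
  have d: "d = 1 - \<omega> * cnj \<omega>" using complex_norm_square[of \<omega>] by (simp add: d_def)
  have nz: "1 + \<mu> * \<omega> \<noteq> 0" "1 - \<omega> \<noteq> 0"
    using one_plus_in_right_half_plane(2)[of "\<mu> * \<omega>"] one_plus_in_right_half_plane(2)[of "- \<omega>"] assms
    by (auto simp: norm_mult)
  have \<mu>': "\<mu> * cnj \<mu> = 1" using complex_norm_square[of \<mu>] \<mu> by simp
  have "\<mu> / (1 + \<mu> * \<omega>) + cnj \<omega> / d = (\<mu> * d + cnj \<omega> * (1 + \<mu> * \<omega>)) / ((1 + \<mu> * \<omega>) * d)"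
    using nz d0 by (simp add: add_frac_eq)
  also have "\<mu> * d + cnj \<omega> * (1 + \<mu> * \<omega>) = \<mu> + \<mu> * cnj \<mu> * cnj \<omega>" unfolding d \<mu>' by (simp add: algebra_simps)
  also have "\<dots> = \<mu> * cnj (1 + \<mu> * \<omega>)" by (simp add: algebra_simps)
  finally have 1: "cmod (\<mu> / (1 + \<mu> * \<omega>) + cnj \<omega> / d) = 1 / (1 - (cmod \<omega>)\<^sup>2)"
    using nz by (simp only: norm_divide norm_mult complex_mod_cnj \<mu> cd) simp
  have "1 / (1 - \<omega>) - cnj \<omega> / d = (d - cnj \<omega> * (1 - \<omega>)) / ((1 - \<omega>) * d)"
    using nz d0 by (simp add: diff_frac_eq)
  also have "d - cnj \<omega> * (1 - \<omega>) = cnj (1 - \<omega>)" unfolding d by (simp add: algebra_simps)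
  finally have 2: "cmod (1 / (1 - \<omega>) - cnj \<omega> / d) = 1 / (1 - (cmod \<omega>)\<^sup>2)"
    using nz by (simp only: norm_divide norm_mult complex_mod_cnj cd) simp
  have "\<mu> / (1 + \<mu> * \<omega>) + 1 / (1 - \<omega>) = (\<mu> / (1 + \<mu> * \<omega>) + cnj \<omega> / d) + (1 / (1 - \<omega>) - cnj \<omega> / d)" by simp
  also have "cmod \<dots> \<le> 1 / (1 - (cmod \<omega>)\<^sup>2) + 1 / (1 - (cmod \<omega>)\<^sup>2)"
    using norm_triangle_ineq[of "\<mu> / (1 + \<mu> * \<omega>) + cnj \<omega> / d" "1 / (1 - \<omega>) - cnj \<omega> / d"] unfolding 1 2 .
  finally show ?thesis by simp
qed

text \<open>
  Integrating the derivative bound gives \<open>ln ((1 + q) / (1 - q))\<close> with \<open>q = |\<omega>|\<close>. The rational majorant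
  has the same linear term and a small cubic one; the final estimate leaves little room for a coarser one.
\<close>

lemma shear_log_bound:
  assumes \<mu>: "cmod \<mu> = 1" and \<omega>: "cmod \<omega> < 1" and small: "(cmod \<omega>)\<^sup>2 \<le> 2 / 3"
  shows "cmod (shear_log \<mu> \<omega>) \<le> 2 * cmod \<omega> / (1 - (cmod \<omega>)\<^sup>2 / 2)"
proof -
  define q where "q = cmod \<omega>"
  have q: "0 \<le> q" "q < 1" "q\<^sup>2 \<le> 2 / 3" using assms by (auto simp: q_def)
  have sq: "(s * q)\<^sup>2 \<le> 2 / 3" if "0 \<le> s" "s \<le> 1" for s
  proof -
    have "(s * q)\<^sup>2 \<le> (1 * q)\<^sup>2" using that q by (intro power_mono mult_right_mono) auto
    then show ?thesis using q by simp
  qed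
  have "cmod (shear_log \<mu> (of_real 1 * \<omega>) - shear_log \<mu> (of_real 0 * \<omega>))
     \<le> 2 * (1 * q) / (1 - (1 * q)\<^sup>2 / 2) - 2 * (0 * q) / (1 - (0 * q)\<^sup>2 / 2)"
  proof (rule differentiable_bound_general[of 0 1 "\<lambda>s. shear_log \<mu> (of_real s * \<omega>)" "\<lambda>s. 2 * (s * q) / (1 - (s * q)\<^sup>2 / 2)"
        "\<lambda>s. \<omega> * (\<mu> / (1 + \<mu> * (of_real s * \<omega>)) + 1 / (1 - of_real s * \<omega>))"
        "\<lambda>s. 2 * q * (1 + (s * q)\<^sup>2 / 2) / (1 - (s * q)\<^sup>2 / 2)\<^sup>2"])
    have lt: "cmod (of_real s * \<omega>) < 1" if "0 \<le> s" "s \<le> 1" for s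
      using that q mult_left_le_one_le[of q s] by (simp add: norm_mult q_def)
    have der: "((\<lambda>s. shear_log \<mu> (of_real s * \<omega>)) has_vector_derivative
       \<omega> * (\<mu> / (1 + \<mu> * (of_real s * \<omega>)) + 1 / (1 - of_real s * \<omega>))) (at s)" if "0 \<le> s" "s \<le> 1" for s
    proof -
      have "((\<lambda>s::real. of_real s * \<omega>) has_vector_derivative \<omega>) (at s)"
        by (auto intro!: derivative_eq_intros)
      from field_vector_diff_chain_at[OF this shear_log_has_derivative[OF \<mu> lt[OF that]]]
      show ?thesis by (simp only: o_def)
    qed
    show "continuous_on {0..1} (\<lambda>s. shear_log \<mu> (complex_of_real s * \<omega>))"
      by (intro continuous_at_imp_continuous_on ballI has_vector_derivative_continuous[OF der]) auto
    show "continuous_on {0..1} (\<lambda>s. 2 * (s * q) / (1 - (s * q)\<^sup>2 / 2))"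
    proof (intro continuous_intros ballI)
      fix s :: real assume "s \<in> {0..1}"
      then have "(s * q)\<^sup>2 \<le> 2 / 3" using sq by simp
      then show "1 - (s * q)\<^sup>2 / 2 \<noteq> 0" by linarith
    qed auto
    fix s :: real assume s: "0 < s" "s < 1"
    show "((\<lambda>s. shear_log \<mu> (of_real s * \<omega>)) has_vector_derivative
       \<omega> * (\<mu> / (1 + \<mu> * (of_real s * \<omega>)) + 1 / (1 - of_real s * \<omega>))) (at s)" using der s by simp
    have sq': "(s * q)\<^sup>2 \<le> 2 / 3" using sq s by simp
    have "((\<lambda>s. 2 * (s * q) / (1 - (s * q)\<^sup>2 / 2)) has_real_derivative
        (2 * q * (1 - (s * q)\<^sup>2 / 2) - 2 * (s * q) * - (2 * (s * q) * q / 2)) / ((1 - (s * q)\<^sup>2 / 2) * (1 - (s * q)\<^sup>2 / 2))) (at s)"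
      using sq' by (auto intro!: derivative_eq_intros simp: mult_ac)
    also have "(2 * q * (1 - (s * q)\<^sup>2 / 2) - 2 * (s * q) * - (2 * (s * q) * q / 2)) / ((1 - (s * q)\<^sup>2 / 2) * (1 - (s * q)\<^sup>2 / 2))
       = 2 * q * (1 + (s * q)\<^sup>2 / 2) / (1 - (s * q)\<^sup>2 / 2)\<^sup>2"
      unfolding power2_eq_square by (rule arg_cong2[where f="(/)"]) (auto simp: algebra_simps)
    finally show "((\<lambda>s. 2 * (s * q) / (1 - (s * q)\<^sup>2 / 2)) has_vector_derivative
        2 * q * (1 + (s * q)\<^sup>2 / 2) / (1 - (s * q)\<^sup>2 / 2)\<^sup>2) (at s)"
      by (simp add: has_real_derivative_iff_has_vector_derivative)
    have "cmod (\<omega> * (\<mu> / (1 + \<mu> * (of_real s * \<omega>)) + 1 / (1 - of_real s * \<omega>))) \<le> q * (2 / (1 - (cmod (of_real s * \<omega>))\<^sup>2))"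
      unfolding norm_mult[of \<omega>] q_def using s by (intro mult_left_mono shear_log_derivative_bound \<mu> lt) auto
    also have "cmod (of_real s * \<omega>) = s * q" using s by (simp add: norm_mult q_def)
    also have "q * (2 / (1 - (s * q)\<^sup>2)) \<le> 2 * q * (1 + (s * q)\<^sup>2 / 2) / (1 - (s * q)\<^sup>2 / 2)\<^sup>2"
    proof -
      define t where "t = (s * q)\<^sup>2"
      have t: "0 \<le> t" "t \<le> 2 / 3" using sq' by (auto simp: t_def)
      have "(1 + t / 2) * (1 - t) - (1 - t / 2)\<^sup>2 = t * (2 - 3 * t) / 4"
        by (simp add: power2_eq_square field_simps)
      moreover have "0 \<le> t * (2 - 3 * t)" using t by simp
      ultimately have "(1 - t / 2)\<^sup>2 \<le> (1 + t / 2) * (1 - t)" by simp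
      moreover have "1 / a \<le> c / b" if "0 < a" "0 < b" "b \<le> c * a" for a b c :: real
        using that by (simp add: pos_divide_le_eq pos_le_divide_eq)
      ultimately have "1 / (1 - t) \<le> (1 + t / 2) / (1 - t / 2)\<^sup>2" using t by simp
      then have "2 * q * (1 / (1 - t)) \<le> 2 * q * ((1 + t / 2) / (1 - t / 2)\<^sup>2)" using q by (intro mult_left_mono) auto
      then show ?thesis by (simp add: t_def mult_ac)
    qed
    finally show "cmod (\<omega> * (\<mu> / (1 + \<mu> * (of_real s * \<omega>)) + 1 / (1 - of_real s * \<omega>)))
       \<le> 2 * q * (1 + (s * q)\<^sup>2 / 2) / (1 - (s * q)\<^sup>2 / 2)\<^sup>2" .
  qed simp
  then show ?thesis by (simp add: q_def shear_log_def)
qed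

lemma exp_shear_log_minus_one_bound:
  assumes \<mu>: "cmod \<mu> = 1" and \<omega>: "cmod \<omega> < 1" and small: "(cmod \<omega>)\<^sup>2 \<le> 2 / 3"
    and \<eta>: "0 \<le> \<eta>" "(cmod \<omega>)\<^sup>2 / 2 + \<eta> * cmod \<omega> < 1"
  shows "cmod (exp (of_real \<eta> * shear_log \<mu> \<omega>) - 1)
     \<le> 2 * \<eta> * cmod \<omega> / (1 - (cmod \<omega>)\<^sup>2 / 2 - \<eta> * cmod \<omega>)"
proof -
  define q where "q = cmod \<omega>"
  define X where "X = 2 * \<eta> * q / (1 - q\<^sup>2 / 2)"
  have d: "1 - q\<^sup>2 / 2 > 0" using small by (simp add: q_def)
  have "\<eta> * cmod (shear_log \<mu> \<omega>) \<le> \<eta> * (2 * q / (1 - q\<^sup>2 / 2))"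
    unfolding q_def by (intro mult_left_mono shear_log_bound assms)
  then have n: "cmod (of_real \<eta> * shear_log \<mu> \<omega>) \<le> X" using \<eta> by (simp add: X_def norm_mult mult.commute mult.left_commute)
  have X: "X < 2" using \<eta>(2) d by (simp add: X_def q_def[symmetric] field_simps)
  have "cmod (exp (of_real \<eta> * shear_log \<mu> \<omega>) - 1)
     \<le> cmod (of_real \<eta> * shear_log \<mu> \<omega>) / (1 - cmod (of_real \<eta> * shear_log \<mu> \<omega>) / 2)"
    using n X by (intro exp_minus_one_bound) auto
  also have "\<dots> \<le> X / (1 - X / 2)" using n X order_trans[OF norm_ge_zero n] by (intro frac_le) auto
  also have "\<dots> = 2 * \<eta> * q / (1 - q\<^sup>2 / 2 - \<eta> * q)"
  proof -
    have *: "2 * (\<eta> * q) / d / (1 - 2 * (\<eta> * q) / d / 2) = 2 * (\<eta> * q) / (d - \<eta> * q)" if "d > 0" for d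
      using that by (simp add: field_simps)
    show ?thesis using *[OF d] by (simp only: X_def mult.assoc)
  qed
  finally show ?thesis by (simp add: q_def)
qed

section \<open>Analytic part of the shear\<close>

lemma inj_on_harmonic_if_analytic_combinations:
  assumes "\<And>\<mu>. cmod \<mu> = 1 \<Longrightarrow> inj_on (\<lambda>z. H z + \<mu> * G z) S"
  shows "inj_on (\<lambda>z. H z + cnj (G z)) S"
proof (rule inj_onI)
  fix a b assume ab: "a \<in> S" "b \<in> S" "H a + cnj (G a) = H b + cnj (G b)"
  define X where "X = G a - G b"
  define \<mu> where "\<mu> = (if X = 0 then 1 else cnj X / X)"
  have \<mu>1: "cmod \<mu> = 1" by (auto simp: \<mu>_def norm_divide)
  have "\<mu> * X = cnj X" by (auto simp: \<mu>_def)
  then have X: "\<mu> * (G a - G b) - (cnj (G a) - cnj (G b)) = 0" by (simp add: X_def)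
  have "H a + \<mu> * G a - (H b + \<mu> * G b) = (H a + cnj (G a)) - (H b + cnj (G b))
      + (\<mu> * (G a - G b) - (cnj (G a) - cnj (G b)))"
    by (simp add: algebra_simps)
  then have "H a + \<mu> * G a = H b + \<mu> * G b" unfolding X ab(3) by simp
  then show "a = b" using inj_onD[OF assms[OF \<mu>1], of a b] ab(1,2) by simp
qed

lemma C_base_properties:
  assumes hol: "\<phi> holomorphic_on unit_disc" and \<phi>0: "\<phi> 0 = 0" "deriv \<phi> 0 = 1" and inj: "inj_on \<phi> unit_disc"
  shows "C_base \<beta> \<phi> holomorphic_on unit_disc" "C_base \<beta> \<phi> 0 = 1"
    "\<And>z. z \<in> unit_disc \<Longrightarrow> C_base \<beta> \<phi> z \<noteq> 0"
proof -
  have pos: "1 - z \<notin> \<real>\<^sub>\<le>\<^sub>0" if "z \<in> unit_disc" for z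
    using that complex_Re_le_cmod[of z] by (auto simp: complex_nonpos_Reals_iff)
  have "(\<lambda>z. if z = 0 then deriv \<phi> 0 else \<phi> z / z) holomorphic_on unit_disc"
    by (rule pole_theorem_open_0[OF hol, of 0]) (auto simp: \<phi>0)
  moreover have "(\<lambda>z. (1 - z) powr of_real \<beta>) holomorphic_on unit_disc"
    using pos by (intro holomorphic_intros) auto
  moreover have nz: "(1 - z) powr of_real \<beta> \<noteq> 0" if "z \<in> unit_disc" for z
    using that by auto
  ultimately show "C_base \<beta> \<phi> holomorphic_on unit_disc"
    unfolding C_base_def[abs_def] by (intro holomorphic_on_divide) auto
  show "C_base \<beta> \<phi> 0 = 1" by (simp add: C_base_def \<phi>0)
  fix z assume z: "z \<in> unit_disc"
  have "\<phi> z \<noteq> 0" if "z \<noteq> 0" using inj_onD[OF inj, of z 0] z that \<phi>0 by auto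
  then show "C_base \<beta> \<phi> z \<noteq> 0" using nz[OF z] \<phi>0 by (auto simp: C_base_def)
qed

lemma C_base_logarithmic_derivative:
  assumes hol: "\<phi> holomorphic_on unit_disc" and z: "z \<in> unit_disc" "z \<noteq> 0" "\<phi> z \<noteq> 0"
  shows "deriv (C_base \<beta> \<phi>) z = C_base \<beta> \<phi> z * (deriv \<phi> z / \<phi> z - 1 / z + of_real \<beta> / (1 - z))"
proof -
  have pos: "1 - z \<notin> \<real>\<^sub>\<le>\<^sub>0" "1 - z \<noteq> 0"
    using z complex_Re_le_cmod[of z] by (auto simp: complex_nonpos_Reals_iff)
  have d\<phi>: "(\<phi> has_field_derivative deriv \<phi> z) (at z)" using hol z by (auto intro: holomorphic_derivI)
  define p where "p = (1 - z) powr of_real \<beta>"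
  have p0: "p \<noteq> 0" using pos by (simp add: p_def)
  have "(1 - z) powr (of_real \<beta> - 1) = p / (1 - z)"
    using pos by (simp add: p_def powr_diff)
  then have dp: "((\<lambda>z. (1 - z) powr of_real \<beta>) has_field_derivative - (of_real \<beta> * p / (1 - z))) (at z)"
    using pos by (auto intro!: derivative_eq_intros simp: has_field_derivative_powr_right)
  have quot: "((b * x - a * 1) / (x * x) * r - a / x * - (t * r / u)) / (r * r) = a / x / r * (b / a - 1 / x + t / u)"
    if "a \<noteq> 0" "x \<noteq> 0" "r \<noteq> 0" "u \<noteq> 0" for a b x r t u :: complex
    using that by (simp add: divide_simps) (simp add: algebra_simps)
  have "((\<lambda>z. \<phi> z / z / (1 - z) powr of_real \<beta>) has_field_derivative
     \<phi> z / z / p * (deriv \<phi> z / \<phi> z - 1 / z + of_real \<beta> / (1 - z))) (at z)"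
    using DERIV_divide[OF DERIV_divide[OF d\<phi> DERIV_ident z(2)] dp p0[unfolded p_def]]
    unfolding p_def[symmetric] quot[OF z(3,2) p0 pos(2)] .
  then have "(C_base \<beta> \<phi> has_field_derivative \<phi> z / z / p * (deriv \<phi> z / \<phi> z - 1 / z + of_real \<beta> / (1 - z))) (at z)"
    by (rule has_field_derivative_transform_within_open[of _ _ _ "unit_disc - {0}"])
       (use z in \<open>auto simp: C_base_def\<close>)
  then show ?thesis using z by (simp add: DERIV_imp_deriv C_base_def p_def)
qed

lemma branch_log_derivative:
  assumes hol: "f holomorphic_on unit_disc" and f0: "f 0 = 1" and nz: "\<And>z. z \<in> unit_disc \<Longrightarrow> f z \<noteq> 0"
    and z: "z \<in> unit_disc"
  shows "deriv (branch_log f) z = deriv f z / f z"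
proof -
  have bl: "branch_log f holomorphic_on unit_disc" "\<And>z. z \<in> unit_disc \<Longrightarrow> exp (branch_log f z) = f z"
    using branch_log[of f] hol f0 nz by auto
  have "(branch_log f has_field_derivative deriv (branch_log f) z) (at z)"
    using bl(1) z by (auto intro: holomorphic_derivI)
  then have "((\<lambda>z. exp (branch_log f z)) has_field_derivative exp (branch_log f z) * deriv (branch_log f) z) (at z)"
    by (auto intro!: derivative_eq_intros)
  then have "(f has_field_derivative exp (branch_log f z) * deriv (branch_log f) z) (at z)"
    by (rule has_field_derivative_transform_within_open[of _ _ _ unit_disc]) (use z bl(2) in auto)
  then have "deriv f z = f z * deriv (branch_log f) z" using bl(2)[OF z] by (simp add: DERIV_imp_deriv)
  then show ?thesis using nz[OF z] by simp
qed

lemma integral_from_origin_has_derivative: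
  assumes hol: "g holomorphic_on unit_disc" and z: "z \<in> unit_disc"
  shows "((\<lambda>z. contour_integral (linepath 0 z) g) has_field_derivative g z) (at z)"
proof -
  obtain F where F: "\<And>x. x \<in> unit_disc \<Longrightarrow> (F has_field_derivative g x) (at x within unit_disc)"
    using holomorphic_convex_primitive'[OF convex_ball open_ball hol] by blast
  have eq: "contour_integral (linepath 0 x) g = F x - F 0" if x: "x \<in> unit_disc" for x
  proof -
    have "path_image (linepath 0 x) \<subseteq> unit_disc"
      unfolding path_image_linepath using x by (intro closed_segment_subset) auto
    then have "(g has_contour_integral F (pathfinish (linepath 0 x)) - F (pathstart (linepath 0 x))) (linepath 0 x)"
      by (intro contour_integral_primitive[OF F]) auto
    then show ?thesis by (simp add: contour_integral_unique)
  qed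
  have "(F has_field_derivative g z) (at z)" using F[OF z] z by (simp add: at_within_open[OF _ open_ball])
  then have "((\<lambda>x. F x - F 0) has_field_derivative g z) (at z)"
    using DERIV_diff[OF _ DERIV_const, of F "g z" z UNIV "F 0"] by simp
  then show ?thesis
    by (rule has_field_derivative_transform_within_open[OF _ open_ball z]) (use eq in simp)
qed

text \<open>
  The derivative is presented as an exponential, so that arbitrary powers of it and of the shear factor
  are available on the disc.
\<close>

lemma C_rot_derivative:
  assumes \<phi>: "\<phi> holomorphic_on unit_disc" "\<phi> 0 = 0" "deriv \<phi> 0 = 1" "inj_on \<phi> unit_disc"
  obtains c where "c holomorphic_on unit_disc"
    "\<And>z. z \<in> unit_disc \<Longrightarrow> (C_rot \<theta> \<alpha> \<beta> \<phi> has_field_derivative exp (c z)) (at z)"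
    "\<And>z. z \<in> unit_disc \<Longrightarrow> z \<noteq> 0 \<Longrightarrow> z * deriv c z = of_real \<alpha> *
       (exp (\<i> * of_real \<theta>) * z * deriv \<phi> (exp (\<i> * of_real \<theta>) * z) / \<phi> (exp (\<i> * of_real \<theta>) * z) - 1
        + of_real \<beta> * (exp (\<i> * of_real \<theta>) * z / (1 - exp (\<i> * of_real \<theta>) * z)))"
proof -
  define e where "e = exp (\<i> * of_real \<theta>)"
  have e: "cmod e = 1" "e \<noteq> 0" "exp (- \<i> * of_real \<theta>) * e = 1"
    by (auto simp: e_def simp flip: exp_add)
  define l where "l = branch_log (C_base \<beta> \<phi>)"
  note Cb = C_base_properties[OF \<phi>, where \<beta> = \<beta>]
  have holl: "l holomorphic_on unit_disc" unfolding l_def using Cb by (intro branch_log(1))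
  define c where "c = (\<lambda>z. of_real \<alpha> * l (e * z))"
  have ein: "e * z \<in> unit_disc" if "z \<in> unit_disc" for z using that e by (simp add: norm_mult)
  have dl: "(l has_field_derivative deriv l (e * z)) (at (e * z))" if "z \<in> unit_disc" for z
    using holl ein[OF that] by (auto intro: holomorphic_derivI)
  have de: "((\<lambda>z. e * z) has_field_derivative e) (at z)" for z
    by (auto intro!: derivative_eq_intros)
  have dc: "(c has_field_derivative of_real \<alpha> * (deriv l (e * z) * e)) (at z)" if "z \<in> unit_disc" for z
    unfolding c_def using DERIV_cmult[OF DERIV_chain2[OF dl[OF that] de]] .
  show ?thesis
  proof (rule that[of c])
    show "c holomorphic_on unit_disc" unfolding holomorphic_on_open[OF open_ball] using dc by blast
    show "(C_rot \<theta> \<alpha> \<beta> \<phi> has_field_derivative exp (c z)) (at z)" if z: "z \<in> unit_disc" for z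
    proof -
      have "(\<lambda>\<zeta>. exp (of_real \<alpha> * l \<zeta>)) holomorphic_on unit_disc" by (intro holomorphic_intros holl)
      from integral_from_origin_has_derivative[OF this ein[OF z]]
      have "(C_op \<alpha> \<beta> \<phi> has_field_derivative exp (c z)) (at (e * z))"
        by (simp only: C_op_def[abs_def] l_def c_def)
      from DERIV_cmult[OF DERIV_chain2[OF this de], of "exp (- \<i> * of_real \<theta>)"]
      have "(C_rot \<theta> \<alpha> \<beta> \<phi> has_field_derivative exp (- \<i> * of_real \<theta>) * (exp (c z) * e)) (at z)"
        by (simp only: C_rot_def[abs_def] e_def)
      also have "exp (- \<i> * of_real \<theta>) * (exp (c z) * e) = exp (c z) * (exp (- \<i> * of_real \<theta>) * e)"
        by (simp only: mult_ac)
      finally show ?thesis unfolding e(3) by simp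
    qed
    show "z * deriv c z = of_real \<alpha> *
       (exp (\<i> * of_real \<theta>) * z * deriv \<phi> (exp (\<i> * of_real \<theta>) * z) / \<phi> (exp (\<i> * of_real \<theta>) * z) - 1
        + of_real \<beta> * (exp (\<i> * of_real \<theta>) * z / (1 - exp (\<i> * of_real \<theta>) * z)))"
      if z: "z \<in> unit_disc" "z \<noteq> 0" for z
    proof -
      define \<zeta> where "\<zeta> = e * z"
      have \<zeta>: "\<zeta> \<in> unit_disc" "\<zeta> \<noteq> 0" using ein z e by (auto simp: \<zeta>_def)
      have "\<phi> \<zeta> \<noteq> 0" using inj_onD[OF \<phi>(4), of \<zeta> 0] \<zeta> \<phi>(2) by auto
      moreover have "deriv l \<zeta> = deriv (C_base \<beta> \<phi>) \<zeta> / C_base \<beta> \<phi> \<zeta>"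
        unfolding l_def using Cb \<zeta>(1) by (intro branch_log_derivative)
      ultimately have "deriv l \<zeta> = deriv \<phi> \<zeta> / \<phi> \<zeta> - 1 / \<zeta> + of_real \<beta> / (1 - \<zeta>)"
        using C_base_logarithmic_derivative[OF \<phi>(1) \<zeta>, of \<beta>] Cb(3)[OF \<zeta>(1)] by simp
      moreover have "z * deriv c z = of_real \<alpha> * (\<zeta> * deriv l \<zeta>)"
        using DERIV_imp_deriv[OF dc[OF z(1)]] by (simp add: \<zeta>_def)
      ultimately show ?thesis using \<zeta> unfolding e_def[symmetric] \<zeta>_def[symmetric]
        by (simp add: distrib_left right_diff_distrib)
    qed
  qed
qed

section \<open>The trade-off between size and hyperbolic derivative\<close>

text \<open>
  The remainder polynomial of \<open>interpolated_bound\<close> at \<open>V = 0\<close>. Its Bernstein form of degree 10 has positive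
  coefficients.
\<close>

lemma remainder_at_zero_nonneg:
  fixes y :: real
  assumes "0 \<le> y" "y \<le> 1"
  shows "35 + 140 * y + 1101 / 4 * y^2 - 2011 / 2 * y^3 + 231 * y^4 - 384 * y^5 + 1512 * y^6 - 588 * y^7 \<ge> 0"
proof -
  have "35 + 140 * y + 1101 / 4 * y^2 - 2011 / 2 * y^3 + 231 * y^4 - 384 * y^5 + 1512 * y^6 - 588 * y^7
    = 35 * (1 - y)^10 + 490 * (y * (1 - y)^9) + 12441 / 4 * (y^2 * (1 - y)^8) + 20873 / 2 * (y^3 * (1 - y)^7)
      + 40019 / 2 * (y^4 * (1 - y)^6) + 43521 / 2 * (y^5 * (1 - y)^5) + 12122 * (y^6 * (1 - y)^4)
      + 4843 / 2 * (y^7 * (1 - y)^3) + 279 / 2 * (y^8 * (1 - y)^2) + 1047 / 2 * (y^9 * (1 - y)) + 863 / 4 * y^10"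
    by algebra
  also have "\<dots> \<ge> 0"
    using assms by (intro add_nonneg_nonneg mult_nonneg_nonneg zero_le_power) auto
  finally show ?thesis .
qed

text \<open>
  The same polynomial at \<open>V = 1\<close>, where degree 7 suffices for the Bernstein form.
\<close>

lemma remainder_at_one_nonneg:
  fixes y :: real
  assumes "0 \<le> y" "y \<le> 1"
  shows "110 - 460 * y + 5169 / 4 * y^2 - 3115 / 2 * y^3 + 711 * y^4 + 768 * y^5 - 168 * y^6 - 588 * y^7 \<ge> 0"
proof -
  have "110 - 460 * y + 5169 / 4 * y^2 - 3115 / 2 * y^3 + 711 * y^4 + 768 * y^5 - 168 * y^6 - 588 * y^7
    = 110 * (1 - y)^7 + 310 * (y * (1 - y)^6) + 3369 / 4 * (y^2 * (1 - y)^5) + 7415 / 4 * (y^3 * (1 - y)^4)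
      + 4107 / 2 * (y^4 * (1 - y)^3) + 3777 / 2 * (y^5 * (1 - y)^2) + 6969 / 4 * (y^6 * (1 - y)) + 431 / 4 * y^7"
    by algebra
  also have "\<dots> \<ge> 0"
    using assms by (intro add_nonneg_nonneg mult_nonneg_nonneg zero_le_power) auto
  finally show ?thesis .
qed

text \<open>
  For fixed \<open>y\<close> the difference of the two sides is a quadratic polynomial in \<open>V\<close>. Its minimum lies near
  \<open>V = 9/10 - 7/10 y\<close>; splitting off the square centred there leaves a polynomial that is linear in
  \<open>V\<close> and needs checking only at \<open>V = 0\<close> and \<open>V = 1\<close>.
\<close>

lemma interpolated_bound:
  fixes y V :: real
  assumes y: "0 \<le> y" "y \<le> 1" and V: "0 \<le> V" "V \<le> 1"
  defines "M \<equiv> 4 / 5 * (y + V * (1 - y\<^sup>2))" and "\<theta> \<equiv> 4 / 5 * y^3"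
  shows "14 / 25 * y * (1 + 117 / 1000 * y + 7 / 50 * y\<^sup>2) + 36 / 25 * (V * (1 - 413 / 500 * y\<^sup>2))
    \<le> 2 / 5 + 3 / 5 * ((1 - \<theta>) * (V * (1 + M)) + \<theta> * (21 / 200 + 21 / 25 * M))" (is "?l \<le> ?r")
proof -
  define P where "P = 35 + 140 * y + 1101 / 4 * y^2 - 2011 / 2 * y^3 + 231 * y^4 - 384 * y^5 + 1512 * y^6 - 588 * y^7"
  define Q where "Q = 110 - 460 * y + 5169 / 4 * y^2 - 3115 / 2 * y^3 + 711 * y^4 + 768 * y^5 - 168 * y^6 - 588 * y^7"
  define V0 where "V0 = 9 / 10 - 7 / 10 * y"
  have "?r - ?l = 12 / 25 * ((1 - \<theta>) * (1 - y\<^sup>2)) * (V - V0)\<^sup>2 + ((1 - V) * P + V * Q) / 3125"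
    unfolding M_def \<theta>_def P_def Q_def V0_def by (simp add: field_simps power2_eq_square power_numeral_reduce)
  moreover have "0 \<le> (1 - \<theta>) * (1 - y\<^sup>2)"
    using y power_le_one[OF y, of 3] power_le_one[OF y, of 2] by (intro mult_nonneg_nonneg) (auto simp: \<theta>_def)
  moreover have "0 \<le> (1 - V) * P + V * Q"
    using V remainder_at_zero_nonneg[OF y] remainder_at_one_nonneg[OF y] unfolding P_def Q_def
    by (intro add_nonneg_nonneg mult_nonneg_nonneg) auto
  ultimately have "0 \<le> ?r - ?l" by simp
  then show ?thesis by simp
qed

text \<open>
  Here \<open>y\<close> and \<open>W\<close> are \<open>|w|\<close> and \<open>|w'| (1 - |z|\<^sup>2)\<close> at a point, and \<open>m\<close> and \<open>w\<close> are the supremum norm and the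
  hyperbolic norm. The right-hand side grows with \<open>m\<close> and \<open>w\<close>, so it is bounded below by the least
  values that \<open>y\<close> and \<open>W\<close> permit: \<open>w\<close> is at least \<open>V = W / (1 - y\<^sup>2)\<close> and, by the hypothesis \<open>big\<close>, at
  least \<open>6/25 (1 + m)\<close>; and \<open>m\<close> is at least \<open>4/5 (y + W)\<close>. The two lower bounds for \<open>w\<close> are mixed with the weight
  \<open>\<theta> = 4/5 y\<^sup>3\<close>: the first one decides for small \<open>y\<close>, the second one for \<open>y\<close> near 1. The exponent \<open>18/25\<close>
  was found numerically; it balances the region of small \<open>y\<close> against that of large \<open>y\<close>.
\<close>

lemma shear_key_inequality:
  fixes y W m w k q :: real
  assumes y: "0 \<le> y" "y \<le> m" and m: "m \<le> 1" and w: "w \<le> m"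
    and W: "0 \<le> W" "W \<le> w * (1 - y\<^sup>2)" "m * W \<le> m\<^sup>2 - y\<^sup>2"
    and big: "2 / 5 + 3 / 5 * (w * (1 + m)) < 2 * w"
    and q: "q = k * y" and k: "0 \<le> k" "k * (2 + w * (1 + m)) \<le> 1"
  shows "14 / 25 * y / (1 - q\<^sup>2 / 2 - 7 / 25 * q) + 36 / 25 * W / (1 - q\<^sup>2) \<le> 2 / 5 + 3 / 5 * (w * (1 + m))"
proof -
  have y1: "y \<le> 1" using y m by simp
  have w_lower: "6 / 25 * (1 + m) \<le> w"
  proof -
    \<comment> \<open>The tangent at \<open>m = 2/3\<close> of the convex lower bound \<open>2 / (7 - 3 m)\<close> for \<open>w\<close>.\<close>
    have "6 / 25 * (1 + m) * (7 / 5 - 3 / 5 * m) = 2 / 5 - 18 / 125 * (m - 2 / 3)\<^sup>2" by algebra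
    also have "\<dots> \<le> 2 / 5" by simp
    also have "2 / 5 \<le> w * (7 / 5 - 3 / 5 * m)" using big by argo
    finally show ?thesis using m by (subst (asm) mult_le_cancel_right) auto
  qed
  have m0: "6 / 19 \<le> m" using w_lower w by simp
  define p where "p = w * (1 + m)"
  have "6 / 25 * (1 + 6 / 19) * (1 + 6 / 19) \<le> p"
    unfolding p_def using w_lower m0 by (intro mult_mono) auto
  then have "2 / 5 \<le> p" by simp
  then have "k * (12 / 5) \<le> k * (2 + p)" using k by (intro mult_left_mono) auto
  then have k': "k \<le> 5 / 12" using k by (simp add: p_def)
  then have q1: "q \<le> 5 / 12 * y" unfolding q using y by (intro mult_right_mono) auto
  have q0: "0 \<le> q" using q k y by simp
  have qq: "q\<^sup>2 \<le> 25 / 144 * y\<^sup>2" using power_mono[OF q1 q0, of 2] by (simp add: power_mult_distrib power2_eq_square)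
  have yy: "0 \<le> y\<^sup>2" "y\<^sup>2 \<le> y" "y\<^sup>2 \<le> 1" using y y1 by (auto simp: power2_eq_square mult_left_le mult_le_one)
  obtain V where V: "0 \<le> V" "V \<le> w" "W = V * (1 - y\<^sup>2)"
  proof (cases "y\<^sup>2 = 1")
    case True
    then show ?thesis using W w m0 w_lower by (intro that[of 0]) auto
  next
    case False
    then have "0 < 1 - y\<^sup>2" using yy by simp
    then show ?thesis using W by (intro that[of "W / (1 - y\<^sup>2)"]) (auto simp: field_simps)
  qed
  define M where "M = 4 / 5 * (y + V * (1 - y\<^sup>2))"
  have M: "M = 4 / 5 * (y + W)" by (simp add: M_def V(3))
  have M0: "0 \<le> M" using y W by (simp add: M)
  have "M \<le> m"
  proof (rule ccontr)
    assume "\<not> M \<le> m"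
    then have "0 < (M - m) * (M + m - W)"
    proof (intro mult_pos_pos)
      have "m * W \<le> m * m" using W(3) yy unfolding power2_eq_square by linarith
      then have "W \<le> m" using m0 by simp
      then show "0 < M + m - W" using \<open>\<not> M \<le> m\<close> m0 by simp
    qed simp
    \<comment> \<open>\<open>m\<close> is at least the larger root of \<open>x\<^sup>2 - W x - y\<^sup>2\<close>, and at \<open>x = M\<close> this polynomial is minus a square.\<close>
    moreover have "(M - m) * (M + m - W) = - (2 / 5 * W - 3 / 5 * y)\<^sup>2 - (m\<^sup>2 - y\<^sup>2 - m * W)"
      unfolding M by algebra
    moreover have "0 \<le> (2 / 5 * W - 3 / 5 * y)\<^sup>2" by simp
    ultimately show False using W(3) by linarith
  qed
  define \<theta> where "\<theta> = 4 / 5 * y^3"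
  have \<theta>: "0 \<le> \<theta>" "\<theta> \<le> 1" using y y1 power_le_one[of y 3] by (auto simp: \<theta>_def)
  have "V * (1 + M) \<le> p" unfolding p_def using V \<open>M \<le> m\<close> M0 by (intro mult_mono) auto
  moreover have "21 / 200 + 21 / 25 * M \<le> p"
  proof -
    \<comment> \<open>The tangent at \<open>M = 3/4\<close>, which makes the bound linear in \<open>M\<close>.\<close>
    have "21 / 200 + 21 / 25 * M = 6 / 25 * (1 + M) * (1 + M) - 6 / 25 * (M - 3 / 4)\<^sup>2" by algebra
    also have "\<dots> \<le> 6 / 25 * (1 + M) * (1 + M)" by simp
    also have "\<dots> \<le> w * (1 + m)" using w_lower \<open>M \<le> m\<close> M0 by (intro mult_mono) auto
    finally show ?thesis by (simp add: p_def)
  qed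
  ultimately have "(1 - \<theta>) * (V * (1 + M)) + \<theta> * (21 / 200 + 21 / 25 * M) \<le> p"
    using \<theta> by (intro convex_bound_le) auto
  moreover have "14 / 25 * y * (1 + 117 / 1000 * y + 7 / 50 * y\<^sup>2) + 36 / 25 * (V * (1 - 413 / 500 * y\<^sup>2))
    \<le> 2 / 5 + 3 / 5 * ((1 - \<theta>) * (V * (1 + M)) + \<theta> * (21 / 200 + 21 / 25 * M))"
    unfolding \<theta>_def M_def using y y1 V w m by (intro interpolated_bound) auto
  moreover have "14 / 25 * y / (1 - q\<^sup>2 / 2 - 7 / 25 * q) \<le> 14 / 25 * y * (1 + 117 / 1000 * y + 7 / 50 * y\<^sup>2)"
  proof -
    define d where "d = 1 - q\<^sup>2 / 2 - 7 / 25 * q"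
    \<comment> \<open>A quadratic majorant of the reciprocal of \<open>d\<close> for \<open>q \<le> 5/12 y\<close>; the linear coefficient is slightly above the derivative \<open>7/60\<close> at 0.\<close>
    define s where "s = 1 + 117 / 1000 * y + 7 / 50 * y\<^sup>2"
    have s: "s > 0" using y by (simp add: s_def add_pos_nonneg)
    have d: "1 - 25 / 288 * y\<^sup>2 - 7 / 60 * y \<le> d" using qq q1 by (simp add: d_def)
    then have d0: "0 < d" using yy y1 by linarith
    have "1 \<le> s * (1 - 25 / 288 * y\<^sup>2 - 7 / 60 * y)"
    proof -
      have "s * (1 - 25 / 288 * y\<^sup>2 - 7 / 60 * y) - 1
         = y / 3000 + y\<^sup>2 * ((7 / 50 - 25 / 288 - 819 / 60000) - (7 / 50 * (7 / 60) + 117 / 1000 * (25 / 288)) * y - 7 / 50 * (25 / 288) * y\<^sup>2)"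
        unfolding s_def by (simp add: field_simps power2_eq_square)
      moreover have "0 \<le> y\<^sup>2 * ((7 / 50 - 25 / 288 - 819 / 60000) - (7 / 50 * (7 / 60) + 117 / 1000 * (25 / 288)) * y - 7 / 50 * (25 / 288) * y\<^sup>2)"
        using yy y1 by (intro mult_nonneg_nonneg) auto
      ultimately show ?thesis using y by linarith
    qed
    also have "\<dots> \<le> s * d" using s d by (intro mult_left_mono) auto
    finally have "y * 1 \<le> y * (s * d)" using y by (intro mult_left_mono) auto
    then have "14 / 25 * y / d \<le> 14 / 25 * y * s" using d0 by (simp add: pos_divide_le_eq mult_ac)
    then show ?thesis unfolding d_def s_def .
  qed
  moreover have "36 / 25 * W / (1 - q\<^sup>2) \<le> 36 / 25 * (V * (1 - 413 / 500 * y\<^sup>2))"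
  proof -
    have q2: "0 < 1 - q\<^sup>2" using qq yy by simp
    have "1 - y\<^sup>2 \<le> (1 - y\<^sup>2 + q\<^sup>2) * (1 - q\<^sup>2)"
    proof -
      have "(1 - y\<^sup>2 + q\<^sup>2) * (1 - q\<^sup>2) = 1 - y\<^sup>2 + q\<^sup>2 * (y\<^sup>2 - q\<^sup>2)" by algebra
      moreover have "0 \<le> q\<^sup>2 * (y\<^sup>2 - q\<^sup>2)" 
      proof (rule mult_nonneg_nonneg)
        show "0 \<le> y\<^sup>2 - q\<^sup>2" using qq yy(1) by linarith
      qed simp
      ultimately show ?thesis by simp
    qed
    also have "\<dots> \<le> (1 - 413 / 500 * y\<^sup>2) * (1 - q\<^sup>2)"
    proof (rule mult_right_mono)
      show "1 - y\<^sup>2 + q\<^sup>2 \<le> 1 - 413 / 500 * y\<^sup>2" using qq yy(1) by linarith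
    qed (use q2 in simp)
    finally have "V * (1 - y\<^sup>2) \<le> V * ((1 - 413 / 500 * y\<^sup>2) * (1 - q\<^sup>2))"
      using V by (intro mult_left_mono)
    then show ?thesis using q2 V(3) by (simp add: field_simps)
  qed
  moreover have "X + Y \<le> 2 / 5 + 3 / 5 * c"
    if "A \<le> c" "L + L' \<le> 2 / 5 + 3 / 5 * A" "X \<le> L" "Y \<le> L'" for A L L' X Y c :: real
    using that by linarith
  ultimately show ?thesis
    unfolding p_def by blast
qed

section \<open>Univalence of the shear\<close>

text \<open>
  On the circle \<open>|z| = r\<close> the values of \<open>(1 - r\<^sup>2) z / (1 - z)\<close> lie on a circle of centre \<open>r\<^sup>2\<close> and radius
  \<open>r\<close>. Subtracting the centre is what makes the contribution of the factor \<open>(1 - \<zeta>)\<^sup>-\<^sup>\<beta>\<close> cheap.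
\<close>

lemma becker_shift:
  fixes z :: complex
  assumes "z \<in> unit_disc"
  shows "cmod (of_real (1 - (cmod z)\<^sup>2) * (z / (1 - z)) - of_real ((cmod z)\<^sup>2)) = cmod z"
proof -
  have z: "1 - z \<noteq> 0" using assms by auto
  have "of_real (1 - (cmod z)\<^sup>2) * (z / (1 - z)) - of_real ((cmod z)\<^sup>2) = z * cnj (1 - z) / (1 - z)"
    using z complex_norm_square[of z] by (simp add: field_simps)
  also have "cmod \<dots> = cmod z" using z by (simp only: norm_divide norm_mult complex_mod_cnj) simp
  finally show ?thesis .
qed

text \<open>
  \<open>loewner_univalence\<close> for \<open>f = H + \<mu> G\<close> and \<open>q = C' T\<^sup>\<nu> / (1 - \<alpha> \<beta>)\<close> with \<open>\<nu> = 1 - \<eta>\<close>. Then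
  \<open>f' / q = (1 - \<alpha> \<beta>) T\<^sup>\<eta>\<close>, whose distance from \<open>1 - \<alpha> \<beta>\<close> is controlled by the size \<open>E\<close> of \<open>T\<^sup>\<eta> - 1\<close>, while
  \<open>z q' / q\<close> contains \<open>\<nu>\<close> times the logarithmic derivative of \<open>T\<close>, controlled by the hyperbolic derivative
  of \<open>k w\<close>. The bounds on \<open>k\<close> and \<open>\<eta>\<close> keep \<open>E < 1\<close>.
\<close>

lemma shear_univalent_criterion:
  fixes \<alpha> \<beta> \<gamma> \<eta> \<theta> k :: real and w :: "complex \<Rightarrow> complex" and E W :: "complex \<Rightarrow> real"
  defines "k \<equiv> \<alpha> * (1 + \<beta>)"
  defines "E \<equiv> \<lambda>z. 2 * \<eta> * (k * cmod (w z)) / (1 - (k * cmod (w z))\<^sup>2 / 2 - \<eta> * (k * cmod (w z)))"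
    and "W \<equiv> \<lambda>z. cmod (deriv w z) * (1 - (cmod z)\<^sup>2)"
  assumes L: "linear_invariant_family L" "family_order L = ereal \<gamma>" "\<phi> \<in> L" and \<gamma>: "1 \<le> \<gamma>"
    and inj: "inj_on \<phi> unit_disc"
    and w: "w holomorphic_on unit_disc" "\<And>z. z \<in> unit_disc \<Longrightarrow> cmod (w z) < 1"
    and shear: "horizontal_shear (C_rot \<theta> \<alpha> \<beta> \<phi>) (\<lambda>z. of_real k * w z) H G"
    and \<alpha>: "0 \<le> \<alpha>" and \<beta>: "0 \<le> \<beta>" and k: "k \<le> 5 / 9" and \<eta>: "0 \<le> \<eta>" "\<eta> \<le> 7 / 25"
    and estimate: "\<And>z. z \<in> unit_disc \<Longrightarrow>
      \<alpha> * (\<gamma> * (1 + cmod z) + (1 - (cmod z)\<^sup>2) + \<beta> * cmod z)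
      + cmod z * (E z + 2 * (1 - \<eta>) * (k * W z / (1 - (k * cmod (w z))\<^sup>2))) \<le> 1"
  shows "inj_on (\<lambda>z. H z + cnj (G z)) unit_disc"
proof (rule inj_on_harmonic_if_analytic_combinations)
  fix \<mu> :: complex assume \<mu>: "cmod \<mu> = 1"
  note \<phi> = linear_invariant_familyD[OF L(1,3)]
  have k0: "0 \<le> k" using \<alpha> \<beta> by (simp add: k_def)
  have ab: "0 \<le> \<alpha> * \<beta>" "\<alpha> * \<beta> < 1"
  proof -
    have "\<alpha> * \<beta> \<le> k" using \<alpha> by (simp add: k_def algebra_simps)
    then show "\<alpha> * \<beta> < 1" using k by simp
  qed (use \<alpha> \<beta> in simp)
  define \<omega> where "\<omega> = (\<lambda>z. of_real k * w z)"
  have c\<omega>: "cmod (\<omega> z) = k * cmod (w z)" for z using k0 by (simp add: \<omega>_def norm_mult)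
  have \<omega>k: "cmod (\<omega> z) \<le> 5 / 9" if "z \<in> unit_disc" for z
  proof -
    have "k * cmod (w z) \<le> 5 / 9 * 1" using k k0 w(2)[OF that] by (intro mult_mono) auto
    then show ?thesis by (simp add: c\<omega>)
  qed
  have hol\<omega>: "\<omega> holomorphic_on unit_disc" unfolding \<omega>_def by (intro holomorphic_intros w(1))
  have d\<omega>: "(\<omega> has_field_derivative of_real k * deriv w z) (at z)" if "z \<in> unit_disc" for z
    unfolding \<omega>_def using w(1) that by (intro DERIV_cmult) (auto intro: holomorphic_derivI)
  have holH: "H holomorphic_on unit_disc" and holG: "G holomorphic_on unit_disc"
    and HG: "\<And>z. z \<in> unit_disc \<Longrightarrow> H z - G z = C_rot \<theta> \<alpha> \<beta> \<phi> z"
    and dG: "\<And>z. z \<in> unit_disc \<Longrightarrow> deriv G z = \<omega> z * deriv H z"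
    using shear by (auto simp: horizontal_shear_def \<omega>_def)
  define e where "e = exp (\<i> * of_real \<theta>)"
  have e: "cmod e = 1" by (simp add: e_def)
  obtain c where c: "c holomorphic_on unit_disc"
    "\<And>z. z \<in> unit_disc \<Longrightarrow> (C_rot \<theta> \<alpha> \<beta> \<phi> has_field_derivative exp (c z)) (at z)"
    "\<And>z. z \<in> unit_disc \<Longrightarrow> z \<noteq> 0 \<Longrightarrow> z * deriv c z = of_real \<alpha> *
       (e * z * deriv \<phi> (e * z) / \<phi> (e * z) - 1 + of_real \<beta> * (e * z / (1 - e * z)))"
    using C_rot_derivative[OF \<phi>(1-3) inj] unfolding e_def by metis
  have dH: "deriv H z * (1 - \<omega> z) = exp (c z)" if z: "z \<in> unit_disc" for z
  proof -
    have "((\<lambda>z. H z - G z) has_field_derivative deriv H z - deriv G z) (at z)"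
      using holH holG z by (intro DERIV_diff) (auto intro: holomorphic_derivI)
    then have "(C_rot \<theta> \<alpha> \<beta> \<phi> has_field_derivative deriv H z - deriv G z) (at z)"
      by (rule has_field_derivative_transform_within_open[OF _ open_ball z]) (rule HG)
    then have "deriv H z - deriv G z = exp (c z)" using c(2)[OF z] DERIV_unique by blast
    then show ?thesis using dG[OF z] by (simp add: algebra_simps)
  qed
  define sl where "sl = (\<lambda>z. shear_log \<mu> (\<omega> z))"
  define S where "S = (\<lambda>z. \<mu> / (1 + \<mu> * \<omega> z) + 1 / (1 - \<omega> z))"
  have dsl: "(sl has_field_derivative S z * (of_real k * deriv w z)) (at z)" if z: "z \<in> unit_disc" for z
    unfolding sl_def S_def using \<omega>k[OF z]
    by (intro DERIV_chain2[OF shear_log_has_derivative[OF \<mu>] d\<omega>[OF z]]) auto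
  define g where "g = (\<lambda>z. c z + of_real (1 - \<eta>) * sl z)"
  define Q where "Q = (\<lambda>z. exp (g z) / of_real (1 - \<alpha> * \<beta>))"
  have dg: "(g has_field_derivative deriv c z + of_real (1 - \<eta>) * (S z * (of_real k * deriv w z))) (at z)"
    if z: "z \<in> unit_disc" for z
    unfolding g_def using c(1) z by (intro DERIV_add DERIV_cmult dsl) (auto intro: holomorphic_derivI)
  have ab0: "complex_of_real (1 - \<alpha> * \<beta>) \<noteq> 0" unfolding of_real_eq_0_iff using ab by simp
  have dQ: "(Q has_field_derivative Q z * (deriv c z + of_real (1 - \<eta>) * (S z * (of_real k * deriv w z)))) (at z)"
    if z: "z \<in> unit_disc" for z
    unfolding Q_def using DERIV_cdivide[OF DERIV_chain2[OF DERIV_exp dg[OF z]], of "of_real (1 - \<alpha> * \<beta>)"]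
    by (simp only: times_divide_eq_left mult.commute)
  have Q0: "Q z \<noteq> 0" for z using ab0 by (simp add: Q_def)
  define f where "f = (\<lambda>z. H z + \<mu> * G z)"
  define B where "B = (\<lambda>z. exp (of_real \<eta> * sl z) - 1)"
  have A: "deriv f z / Q z - 1 = - of_real (\<alpha> * \<beta>) + of_real (1 - \<alpha> * \<beta>) * B z" if z: "z \<in> unit_disc" for z
  proof -
    have "(f has_field_derivative deriv H z + \<mu> * deriv G z) (at z)"
      unfolding f_def using holH holG z by (intro DERIV_add DERIV_cmult) (auto intro: holomorphic_derivI)
    then have "deriv f z = deriv H z * (1 + \<mu> * \<omega> z)"
      using dG[OF z] by (simp add: DERIV_imp_deriv algebra_simps)
    also have "\<dots> = exp (c z) * exp (sl z)"
    proof -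
      have \<omega>1: "cmod (\<omega> z) < 1" using \<omega>k[OF z] by simp
      then have "1 - \<omega> z \<noteq> 0" by auto
      then show ?thesis unfolding sl_def exp_shear_log[OF \<mu> \<omega>1] dH[OF z, symmetric] by simp
    qed
    finally have f': "deriv f z = exp (c z) * exp (sl z)" .
    have "sl z = of_real (1 - \<eta>) * sl z + of_real \<eta> * sl z" by (simp add: algebra_simps)
    then have "exp (c z) * exp (sl z) = exp (g z) * exp (of_real \<eta> * sl z)"
      unfolding g_def by (metis exp_add add.assoc)
    then have "deriv f z / Q z = of_real (1 - \<alpha> * \<beta>) * exp (of_real \<eta> * sl z)"
      unfolding f' Q_def by simp
    then show ?thesis by (simp add: B_def algebra_simps)
  qed
  have BE: "cmod (B z) \<le> E z" and E0: "0 \<le> E z" and E1: "E z < 1" if z: "z \<in> unit_disc" for z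
  proof -
    define q where "q = cmod (\<omega> z)"
    have q: "0 \<le> q" "q \<le> 5 / 9" using \<omega>k[OF z] by (auto simp: q_def)
    have q2: "q\<^sup>2 \<le> 25 / 81" using power_mono[OF q(2,1), of 2] by (simp add: power_divide)
    have \<eta>q: "\<eta> * q \<le> 7 / 25 * (5 / 9)" using \<eta> q by (intro mult_mono) auto
    have \<eta>q0: "0 \<le> \<eta> * q" using \<eta> q by simp
    have Eq: "E z = 2 * \<eta> * q / (1 - q\<^sup>2 / 2 - \<eta> * q)" by (simp add: E_def q_def c\<omega>)
    show "cmod (B z) \<le> E z"
      unfolding Eq B_def sl_def q_def using q2 \<eta>q q \<eta>
      by (intro exp_shear_log_minus_one_bound[OF \<mu>]) (auto simp: q_def)
    show "0 \<le> E z" unfolding Eq using q2 \<eta>q \<eta>q0 by (intro divide_nonneg_nonneg) auto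
    have "0 < 1 - q\<^sup>2 / 2 - \<eta> * q" using q2 \<eta>q by simp
    then show "E z < 1" unfolding Eq using q2 \<eta>q by (simp add: pos_divide_less_eq)
  qed
  show "inj_on (\<lambda>z. H z + \<mu> * G z) unit_disc"
    unfolding f_def[symmetric]
  proof (rule loewner_univalence)
    show "f holomorphic_on unit_disc" unfolding f_def by (intro holomorphic_intros holH holG)
    show "Q holomorphic_on unit_disc" unfolding holomorphic_on_open[OF open_ball] using dQ by blast
    show "Q z \<noteq> 0" for z by (rule Q0)
    fix z assume z: "z \<in> unit_disc"
    have nB: "cmod (of_real (1 - \<alpha> * \<beta>) * B z) = (1 - \<alpha> * \<beta>) * cmod (B z)"
      unfolding norm_mult norm_of_real using ab by simp
    have "cmod (deriv f z / Q z - 1) \<le> \<alpha> * \<beta> + (1 - \<alpha> * \<beta>) * cmod (B z)"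
      unfolding A[OF z] nB[symmetric]
      using norm_triangle_ineq[of "- of_real (\<alpha> * \<beta>)" "of_real (1 - \<alpha> * \<beta>) * B z"] ab
      unfolding norm_minus_cancel norm_of_real by simp
    also have "\<dots> < \<alpha> * \<beta> + (1 - \<alpha> * \<beta>) * 1"
      using BE[OF z] E1[OF z] ab by (intro add_strict_left_mono mult_strict_left_mono) auto
    finally show "cmod (deriv f z / Q z - 1) < 1" by simp
    define r where "r = cmod z"
    have r: "0 \<le> r" "r < 1" "r\<^sup>2 \<le> r" using z by (auto simp: r_def power2_eq_square mult_left_le)
    have r2: "0 \<le> 1 - r\<^sup>2" using r by simp
    show "cmod (of_real ((cmod z)\<^sup>2) * (deriv f z / Q z - 1)
            + of_real (1 - (cmod z)\<^sup>2) * (z * deriv Q z / Q z)) \<le> 1"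
    proof (cases "z = 0")
      case True then show ?thesis by simp
    next
      case False
      define \<zeta> where "\<zeta> = e * z"
      have c\<zeta>: "cmod \<zeta> = r" using e by (simp add: \<zeta>_def r_def norm_mult)
      then have \<zeta>: "\<zeta> \<in> unit_disc" using r by simp
      define X1 where "X1 = of_real \<alpha> * (of_real (1 - r\<^sup>2) * (\<zeta> * deriv \<phi> \<zeta> / \<phi> \<zeta>))"
      define X2 where "X2 = of_real \<alpha> * (of_real (1 - r\<^sup>2) :: complex)"
      define X3 where "X3 = of_real (\<alpha> * \<beta>) * (of_real (1 - r\<^sup>2) * (\<zeta> / (1 - \<zeta>)) - of_real (r\<^sup>2))"
      define X4 where "X4 = of_real (r\<^sup>2) * (of_real (1 - \<alpha> * \<beta>) * B z)"
      define X5 where "X5 = of_real (1 - \<eta>) * (S z * (z * (of_real k * (deriv w z * of_real (1 - r\<^sup>2)))))"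
      define P R where "P = \<zeta> * deriv \<phi> \<zeta> / \<phi> \<zeta>" and "R = \<zeta> / (1 - \<zeta>)"
      have "z * deriv Q z / Q z = z * (deriv c z + of_real (1 - \<eta>) * (S z * (of_real k * deriv w z)))"
        unfolding DERIV_imp_deriv[OF dQ[OF z]] using Q0[of z] by simp
      also have "\<dots> = z * deriv c z + of_real (1 - \<eta>) * (S z * (z * (of_real k * deriv w z)))"
        by (simp add: algebra_simps)
      also have "z * deriv c z = of_real \<alpha> * (\<zeta> * deriv \<phi> \<zeta> / \<phi> \<zeta> - 1 + of_real \<beta> * (\<zeta> / (1 - \<zeta>)))"
        using c(3)[OF z False] by (simp add: \<zeta>_def)
      finally have zQ: "z * deriv Q z / Q z = of_real \<alpha> * (\<zeta> * deriv \<phi> \<zeta> / \<phi> \<zeta> - 1 + of_real \<beta> * (\<zeta> / (1 - \<zeta>)))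
          + of_real (1 - \<eta>) * (S z * (z * (of_real k * deriv w z)))" .
      have total: "of_real ((cmod z)\<^sup>2) * (deriv f z / Q z - 1) + of_real (1 - (cmod z)\<^sup>2) * (z * deriv Q z / Q z)
         = X1 - X2 + X3 + X4 + X5"
        unfolding A[OF z] zQ X1_def X2_def X3_def X4_def X5_def r_def
          P_def[symmetric] R_def[symmetric] by (simp add: algebra_simps)
      have "cmod (X1 - X2 + X3 + X4 + X5) \<le> cmod X1 + cmod X2 + cmod X3 + cmod X4 + cmod X5"
        using norm_triangle_ineq[of "X1 - X2 + X3 + X4" X5] norm_triangle_ineq[of "X1 - X2 + X3" X4]
          norm_triangle_ineq[of "X1 - X2" X3] norm_triangle_ineq4[of X1 X2] by linarith
      moreover have "cmod X1 \<le> \<alpha> * (\<gamma> * (1 + r))"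
      proof -
        have "cmod X1 = \<alpha> * ((1 - r\<^sup>2) * cmod (\<zeta> * deriv \<phi> \<zeta> / \<phi> \<zeta>))"
          unfolding X1_def norm_mult norm_of_real using \<alpha> r2 by (simp add: norm_mult)
        also have "\<dots> \<le> \<alpha> * (\<gamma> * (1 + r))"
          using univalent_log_derivative_bound[OF L \<gamma> inj \<zeta>] \<alpha> unfolding c\<zeta> by (intro mult_left_mono)
        finally show ?thesis .
      qed
      moreover have "cmod X2 = \<alpha> * (1 - r\<^sup>2)"
        unfolding X2_def norm_mult norm_of_real using \<alpha> r2 by simp
      moreover have "cmod X3 = \<alpha> * \<beta> * r"
        unfolding X3_def norm_mult norm_of_real using becker_shift[OF \<zeta>] ab unfolding c\<zeta> by simp
      moreover have "cmod X4 \<le> r * E z"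
      proof -
        have "cmod X4 = r\<^sup>2 * ((1 - \<alpha> * \<beta>) * cmod (B z))"
          unfolding X4_def norm_mult[of "of_real (r\<^sup>2)"] nB norm_of_real by simp
        also have "\<dots> \<le> r * (1 * E z)"
          using r ab BE[OF z] by (intro mult_mono) auto
        finally show ?thesis by simp
      qed
      moreover have "cmod X5 \<le> r * (2 * (1 - \<eta>) * (k * W z / (1 - (k * cmod (w z))\<^sup>2)))"
      proof -
        have "cmod X5 = (1 - \<eta>) * (cmod (S z) * (r * (k * W z)))"
          unfolding X5_def norm_mult norm_of_real W_def r_def[symmetric] using \<eta> k0 r2 by simp
        also have "\<dots> \<le> (1 - \<eta>) * (2 / (1 - (cmod (\<omega> z))\<^sup>2) * (r * (k * W z)))"
          unfolding S_def using \<omega>k[OF z] \<eta> r k0 z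
          by (intro mult_left_mono mult_right_mono shear_log_derivative_bound[OF \<mu>])
             (auto simp: W_def power_le_one)
        also have "\<dots> = r * (2 * (1 - \<eta>) * (k * W z / (1 - (k * cmod (w z))\<^sup>2)))"
          unfolding c\<omega> by simp
        finally show ?thesis .
      qed
      moreover have "\<alpha> * (\<gamma> * (1 + r)) + \<alpha> * (1 - r\<^sup>2) + \<alpha> * \<beta> * r + r * E z
          + r * (2 * (1 - \<eta>) * (k * W z / (1 - (k * cmod (w z))\<^sup>2))) \<le> 1"
        using estimate[OF z] unfolding r_def[symmetric] by (simp only: distrib_left mult.assoc add.assoc)
      ultimately have "cmod (X1 - X2 + X3 + X4 + X5) \<le> 1" by linarith
      then show ?thesis unfolding total .
    qed
  qed
qed

text \<open>
  The bound on \<open>\<alpha>\<close> is what the total cost requires at \<open>r = 1\<close>. For smaller \<open>r\<close> the slack is a multiple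
  of \<open>1 - r\<close>, with a factor that the last hypothesis makes nonnegative.
\<close>

lemma boundary_budget:
  fixes \<alpha> \<beta> \<gamma> p r Y :: real
  assumes \<alpha>: "0 \<le> \<alpha>" "\<alpha> \<le> 1 / (2 * \<gamma> + 2 * \<beta> + (1 + \<beta>) * p)" and \<beta>: "0 \<le> \<beta>" and \<gamma>: "1 \<le> \<gamma>" and p: "0 \<le> p"
    and r: "0 \<le> r" "r \<le> 1" and Y: "(1 + \<beta>) * Y \<le> (1 + \<beta>) * p + \<beta>" and big: "1 \<le> (1 + \<beta>) * p + 2 * \<beta>"
  shows "\<alpha> * (\<gamma> * (1 + r) + (1 - r\<^sup>2) + \<beta> * r) + r * (\<alpha> * (1 + \<beta>) * Y) \<le> 1"
proof -
  define D where "D = 2 * \<gamma> + 2 * \<beta> + (1 + \<beta>) * p"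
  have "0 \<le> (1 + \<beta>) * p" using \<beta> p by simp
  then have D: "D > 0" using \<gamma> \<beta> by (simp add: D_def)
  have "\<gamma> * (1 + r) + (1 - r\<^sup>2) + \<beta> * r + r * ((1 + \<beta>) * Y) \<le> \<gamma> * (1 + r) + (1 - r\<^sup>2) + \<beta> * r + r * ((1 + \<beta>) * p + \<beta>)"
    using Y r by (intro add_left_mono mult_left_mono)
  also have "\<dots> = D - (1 - r) * (\<gamma> - 1 - r + ((1 + \<beta>) * p + 2 * \<beta>))"
    by (simp add: D_def power2_eq_square algebra_simps)
  also have "\<dots> \<le> D" using r \<gamma> big by simp
  finally have "\<alpha> * (\<gamma> * (1 + r) + (1 - r\<^sup>2) + \<beta> * r + r * ((1 + \<beta>) * Y)) \<le> \<alpha> * D"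
    using \<alpha> by (intro mult_left_mono)
  also have "\<dots> \<le> 1" using \<alpha>(2) D unfolding D_def[symmetric] by (simp add: pos_le_divide_eq)
  finally show ?thesis by (simp add: algebra_simps)
qed

text \<open>
  The surplus \<open>1\<close> on the right absorbs the summand \<open>1 - r\<^sup>2\<close>, and the smallness of \<open>u\<close>, the scaled
  hyperbolic norm, keeps the terms that grow with \<open>r\<close> below \<open>1 - r + r\<^sup>2\<close>.
\<close>

lemma interior_budget:
  fixes \<beta> \<gamma> u r :: real
  assumes \<gamma>: "1 \<le> \<gamma>" and \<beta>: "0 \<le> \<beta>" and u: "0 \<le> u" "u \<le> 1 - 3 / 2 * \<beta>" and r: "0 \<le> r" "r \<le> 1"
  shows "\<gamma> * (1 + r) + (1 - r\<^sup>2) + \<beta> * r + r * (2 * u) \<le> 2 * \<gamma> + 1 + u"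
proof -
  have \<beta>': "\<beta> \<le> 2 / 3" using u by simp
  have sq: "0 \<le> 1 - 5 / 3 * r + r\<^sup>2"
  proof -
    have "1 - 5 / 3 * r + r\<^sup>2 = (r - 5 / 6)\<^sup>2 + 11 / 36" by (simp add: power2_eq_square algebra_simps)
    then show ?thesis by simp
  qed
  have "\<beta> * r + u * (2 * r - 1) \<le> 1 - r + r\<^sup>2"
  proof (cases "r \<le> 1 / 2")
    case True
    have "\<beta> * r \<le> 2 / 3 * r" using \<beta>' r by (intro mult_right_mono)
    moreover have "u * (2 * r - 1) \<le> 0" using True u by (intro mult_nonneg_nonpos) auto
    ultimately show ?thesis using sq by simp
  next
    case False
    then have "u * (2 * r - 1) \<le> (1 - 3 / 2 * \<beta>) * (2 * r - 1)" using u by (intro mult_right_mono) auto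
    then have 1: "\<beta> * r + u * (2 * r - 1) \<le> 2 * r - 1 + \<beta> * (3 / 2 - 2 * r)"
    proof -
      have "(1 - 3 / 2 * \<beta>) * (2 * r - 1) = 2 * r - 1 + \<beta> * (3 / 2 - 2 * r) - \<beta> * r" by (simp add: field_simps)
      then show ?thesis using \<open>u * (2 * r - 1) \<le> (1 - 3 / 2 * \<beta>) * (2 * r - 1)\<close> by linarith
    qed
    show ?thesis
    proof (cases "r \<le> 3 / 4")
      case True
      then have "\<beta> * (3 / 2 - 2 * r) \<le> 2 / 3 * (3 / 2 - 2 * r)" using \<beta>' by (intro mult_right_mono) auto
      also have "\<dots> = 1 - 4 / 3 * r" by simp
      finally show ?thesis using 1 sq by linarith
    next
      case False
      then have "\<beta> * (3 / 2 - 2 * r) \<le> 0" using \<beta> by (intro mult_nonneg_nonpos) auto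
      moreover have "0 \<le> (1 - r) * (2 - r)" using r by simp
      ultimately show ?thesis using 1 by (simp add: power2_eq_square algebra_simps)
    qed
  qed
  moreover have "1 - r \<le> \<gamma> * (1 - r)" using mult_right_mono[OF \<gamma>, of "1 - r"] r by simp
  ultimately show ?thesis by (simp add: algebra_simps)
qed

theorem theorem3p9:
  fixes \<gamma> \<theta> \<alpha> \<beta> :: real
    and L :: "(complex \<Rightarrow> complex) set"
    and \<phi> w H G :: "complex \<Rightarrow> complex"
  assumes "1 \<le> \<gamma>"
    and "linear_invariant_family L" and "family_order L = ereal \<gamma>"
    and "\<phi> \<in> L" and "inj_on \<phi> unit_disc"
    and "0 \<le> \<theta>" and "\<theta> < pi"
    and "w holomorphic_on unit_disc" and "\<And>z. z \<in> unit_disc \<Longrightarrow> cmod (w z) < 1"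
    and "horizontal_shear (C_rot \<theta> \<alpha> \<beta> \<phi>) (\<lambda>z. of_real (\<alpha> * (1 + \<beta>)) * w z) H G"
    and "sense_preserving H G"
  shows
    "(1 \<le> \<beta> \<longrightarrow>
        0 \<le> \<alpha> \<and> \<alpha> \<le> 1 / (2 * \<gamma> + 2 * \<beta> + (1 + \<beta>) * hyp_norm w * (1 + sup_norm w)) \<longrightarrow>
        (\<lambda>z. H z + cnj (G z)) \<in> S_H) \<and>
     (0 \<le> \<beta> \<and> \<beta> < 1 \<longrightarrow>
        (\<beta> + 2 * (1 + \<beta>) * hyp_norm w * (1 + sup_norm w) \<le> 2 * (1 - \<beta>) \<longrightarrow>
           0 \<le> \<alpha> \<and>
           \<alpha> \<le> 4 * (1 - \<beta>) /
                (4 * (2 * \<gamma> + 1) * (1 - \<beta>)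
                 + (\<beta> + (1 + \<beta>) * hyp_norm w * (1 + sup_norm w))\<^sup>2
                 + 4 * (1 - \<beta>\<^sup>2) * hyp_norm w) \<longrightarrow>
           (\<lambda>z. H z + cnj (G z)) \<in> S_H) \<and>
        (\<beta> + 2 * (1 + \<beta>) * hyp_norm w * (1 + sup_norm w) > 2 * (1 - \<beta>) \<longrightarrow>
           0 \<le> \<alpha> \<and> \<alpha> \<le> 1 / (2 * \<gamma> + 2 * \<beta> + (1 + \<beta>) * hyp_norm w * (1 + sup_norm w)) \<longrightarrow>
           (\<lambda>z. H z + cnj (G z)) \<in> S_H))"
proof -
  define h m p k where "h = hyp_norm w" and "m = sup_norm w" and "p = h * (1 + m)" and "k = \<alpha> * (1 + \<beta>)"
  have m: "0 \<le> m" "m \<le> 1" and wm: "\<And>z. z \<in> unit_disc \<Longrightarrow> cmod (w z) \<le> m"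
    using sup_norm_bounds[of w] assms(9) by (auto simp: m_def)
  have h: "0 \<le> h" "h \<le> m" and wh: "\<And>z. z \<in> unit_disc \<Longrightarrow>
      cmod (deriv w z) * (1 - (cmod z)\<^sup>2) \<le> h * (1 - (cmod (w z))\<^sup>2)"
    using hyp_norm_bounds[of w] assms(8,9) by (auto simp: m_def h_def)
  have p: "0 \<le> p" "h \<le> p" using m h by (auto simp: p_def algebra_simps)
  have member: "(\<lambda>z. H z + cnj (G z)) \<in> S_H" if "inj_on (\<lambda>z. H z + cnj (G z)) unit_disc"
    using that assms(10) unfolding S_H_def horizontal_shear_def by blast
  note criterion = shear_univalent_criterion[OF assms(2,3,4,1,5,8,9,10)]
  \<comment> \<open>The exponent \<open>\<nu> = 1\<close>: the dilatation costs \<open>2 h\<close> in units of \<open>r k\<close>.\<close>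
  have via_ratio: "(\<lambda>z. H z + cnj (G z)) \<in> S_H"
    if \<alpha>: "0 \<le> \<alpha>" and \<beta>: "0 \<le> \<beta>" and k: "k \<le> 5 / 9"
      and est: "\<And>r. 0 \<le> r \<Longrightarrow> r \<le> 1 \<Longrightarrow> \<alpha> * (\<gamma> * (1 + r) + (1 - r\<^sup>2) + \<beta> * r) + r * (k * (2 * h)) \<le> 1"
  proof (rule member, rule criterion[where \<eta> = 0])
    fix z assume z: "z \<in> unit_disc"
    define y W where "y = cmod (w z)" and "W = cmod (deriv w z) * (1 - (cmod z)\<^sup>2)"
    have k0: "0 \<le> k" using \<alpha> \<beta> by (simp add: k_def)
    have y: "0 \<le> y" "y < 1" using assms(9)[OF z] by (auto simp: y_def)
    have "k * y \<le> 1 * y" using k y by (intro mult_right_mono) auto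
    then have "(k * y)\<^sup>2 \<le> y\<^sup>2" using k0 y by (intro power_mono) auto
    moreover have "y\<^sup>2 < 1" using y by (simp add: power_less_one_iff)
    ultimately have ky: "0 < 1 - (k * y)\<^sup>2" "1 - y\<^sup>2 \<le> 1 - (k * y)\<^sup>2" by auto
    have "W \<le> h * (1 - y\<^sup>2)" using wh[OF z] by (simp add: W_def y_def)
    also have "\<dots> \<le> h * (1 - (k * y)\<^sup>2)" using ky h by (intro mult_left_mono) auto
    finally have "k * W \<le> k * (h * (1 - (k * y)\<^sup>2))" using k0 by (intro mult_left_mono)
    then have "k * W / (1 - (k * y)\<^sup>2) \<le> k * h" using ky by (simp add: pos_divide_le_eq mult_ac)
    then have "cmod z * (2 * (k * W / (1 - (k * y)\<^sup>2))) \<le> cmod z * (k * (2 * h))"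
      by (intro mult_left_mono) auto
    moreover have "\<alpha> * (\<gamma> * (1 + cmod z) + (1 - (cmod z)\<^sup>2) + \<beta> * cmod z) + cmod z * (k * (2 * h)) \<le> 1"
      using z by (intro est) auto
    ultimately show "\<alpha> * (\<gamma> * (1 + cmod z) + (1 - (cmod z)\<^sup>2) + \<beta> * cmod z) +
         cmod z * (2 * 0 * (\<alpha> * (1 + \<beta>) * cmod (w z)) /
           (1 - (\<alpha> * (1 + \<beta>) * cmod (w z))\<^sup>2 / 2 - 0 * (\<alpha> * (1 + \<beta>) * cmod (w z))) +
          2 * (1 - 0) * (\<alpha> * (1 + \<beta>) * (cmod (deriv w z) * (1 - (cmod z)\<^sup>2)) /
             (1 - (\<alpha> * (1 + \<beta>) * cmod (w z))\<^sup>2))) \<le> 1"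
      unfolding k_def[symmetric] y_def[symmetric] W_def[symmetric] by simp
  qed (use \<alpha> \<beta> k in \<open>auto simp: k_def\<close>)
  have boundary_case: "(\<lambda>z. H z + cnj (G z)) \<in> S_H"
    if \<alpha>: "0 \<le> \<alpha>" "\<alpha> \<le> 1 / (2 * \<gamma> + 2 * \<beta> + (1 + \<beta>) * p)" and \<beta>: "0 \<le> \<beta>"
      and big: "1 \<le> \<beta> \<or> 1 - 3 / 2 * \<beta> \<le> (1 + \<beta>) * p"
  proof -
    have k0: "0 \<le> k" using \<alpha> \<beta> by (simp add: k_def)
    have big': "1 \<le> (1 + \<beta>) * p + 2 * \<beta>" using big \<beta> p by (auto intro: add_nonneg_nonneg simp: add_increasing)
    have kp: "k * (2 + p) \<le> 1"
    proof -
      define D where "D = 2 * \<gamma> + 2 * \<beta> + (1 + \<beta>) * p"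
      have "0 \<le> (1 + \<beta>) * p" using \<beta> p by simp
      then have D: "0 < D" "(1 + \<beta>) * (2 + p) \<le> D" using assms(1) \<beta> by (auto simp: D_def distrib_left)
      have "\<alpha> * ((1 + \<beta>) * (2 + p)) \<le> \<alpha> * D" using D \<alpha> by (intro mult_left_mono)
      also have "\<dots> \<le> 1" using \<alpha>(2) D(1) unfolding D_def[symmetric] by (simp add: pos_le_divide_eq)
      finally show ?thesis by (simp add: k_def mult.assoc)
    qed
    have "k * 2 \<le> k * (2 + p)" using k0 p by (intro mult_left_mono) auto
    then have k59: "k \<le> 5 / 9" using kp by simp
    note budget = boundary_budget[OF \<alpha> \<beta> assms(1) p(1) _ _ _ big']
    show ?thesis
    proof (cases "(1 + \<beta>) * (2 * h) \<le> (1 + \<beta>) * p + \<beta>")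
      case True
      show ?thesis
        using \<alpha> \<beta> k59 budget[OF _ _ True] by (intro via_ratio) (auto simp: k_def)
    next
      case False
      have \<beta>3: "\<beta> < 1 / 3"
      proof (rule ccontr)
        assume \<beta>': "\<not> \<beta> < 1 / 3"
        \<comment> \<open>For \<open>\<beta> \<ge> 1/3\<close> the choice \<open>\<nu> = 1\<close> suffices, as \<open>m (1 - m) \<le> 1/4 \<le> \<beta> / (1 + \<beta>)\<close>.\<close>
        have "h * (1 - m) \<le> m * (1 - m)" using h m by (intro mult_right_mono) auto
        also have "m * (1 - m) = 1 / 4 - (m - 1 / 2)\<^sup>2" by (simp add: power2_eq_square algebra_simps)
        also have "\<dots> \<le> 1 / 4" by simp
        finally have "(1 + \<beta>) * (h * (1 - m)) \<le> (1 + \<beta>) * (1 / 4)" using \<beta> by (intro mult_left_mono) auto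
        also have "\<dots> \<le> \<beta>" using \<beta>' by simp
        finally show False using False by (simp add: p_def algebra_simps)
      qed
      then have sp: "1 - 3 / 2 * \<beta> \<le> (1 + \<beta>) * p" using big by auto
      \<comment> \<open>By \<open>sp\<close> the summand \<open>\<beta> / (1 + \<beta>)\<close> is at least \<open>2/5 (1 - p)\<close>; this removes \<open>\<beta>\<close> from what remains to be shown.\<close>
      then have Y: "(1 + \<beta>) * (2 / 5 + 3 / 5 * p) \<le> (1 + \<beta>) * p + \<beta>"
      proof -
        define T where "T = (1 + \<beta>) * p"
        have "(1 + \<beta>) * (2 / 5 + 3 / 5 * p) = 2 / 5 * (1 + \<beta>) + 3 / 5 * T"
          unfolding T_def by (simp add: field_simps)
        also have "\<dots> \<le> T + \<beta>" using sp unfolding T_def[symmetric] by (simp add: field_simps)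
        finally show ?thesis unfolding T_def .
      qed
      have nA: "2 / 5 + 3 / 5 * p < 2 * h"
      proof (rule ccontr)
        assume "\<not> 2 / 5 + 3 / 5 * p < 2 * h"
        then have "(1 + \<beta>) * (2 * h) \<le> (1 + \<beta>) * (2 / 5 + 3 / 5 * p)" using \<beta> by (intro mult_left_mono) auto
        then show False using Y False by simp
      qed
      show ?thesis
      proof (rule member, rule criterion[where \<eta> = "7 / 25"])
        fix z assume z: "z \<in> unit_disc"
        define y W where "y = cmod (w z)" and "W = cmod (deriv w z) * (1 - (cmod z)\<^sup>2)"
        have "14 / 25 * y / (1 - (k * y)\<^sup>2 / 2 - 7 / 25 * (k * y)) + 36 / 25 * W / (1 - (k * y)\<^sup>2)
           \<le> 2 / 5 + 3 / 5 * (h * (1 + m))"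
        proof (rule shear_key_inequality)
          show "m * W \<le> m\<^sup>2 - y\<^sup>2"
            using schwarz_pick_sup_norm[OF assms(8,9) z] by (simp add: m_def W_def y_def)
          show "0 \<le> W" using z by (simp add: W_def power_le_one)
        qed (use wm[OF z] wh[OF z] m h k0 kp nA in \<open>auto simp: y_def W_def p_def\<close>)
        then have "k * (14 / 25 * y / (1 - (k * y)\<^sup>2 / 2 - 7 / 25 * (k * y)) + 36 / 25 * W / (1 - (k * y)\<^sup>2))
           \<le> k * (2 / 5 + 3 / 5 * p)"
          using k0 unfolding p_def by (intro mult_left_mono)
        then have weighted: "cmod z * (k * (14 / 25 * y / (1 - (k * y)\<^sup>2 / 2 - 7 / 25 * (k * y)) + 36 / 25 * W / (1 - (k * y)\<^sup>2)))
           \<le> cmod z * (k * (2 / 5 + 3 / 5 * p))" by (rule mult_left_mono) simp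
        have total: "\<alpha> * (\<gamma> * (1 + cmod z) + (1 - (cmod z)\<^sup>2) + \<beta> * cmod z) + cmod z * (k * (2 / 5 + 3 / 5 * p)) \<le> 1"
          using budget[OF _ _ Y, of "cmod z"] z by (simp add: k_def)
        have split: "k * (14 / 25 * y / a + 36 / 25 * W / b) = 2 * (7 / 25) * (k * y) / a + 2 * (1 - 7 / 25) * (k * W / b)"
          for a b by (simp add: distrib_left)
        show "\<alpha> * (\<gamma> * (1 + cmod z) + (1 - (cmod z)\<^sup>2) + \<beta> * cmod z) +
           cmod z * (2 * (7 / 25) * (\<alpha> * (1 + \<beta>) * cmod (w z)) /
             (1 - (\<alpha> * (1 + \<beta>) * cmod (w z))\<^sup>2 / 2 - 7 / 25 * (\<alpha> * (1 + \<beta>) * cmod (w z))) +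
            2 * (1 - 7 / 25) * (\<alpha> * (1 + \<beta>) * (cmod (deriv w z) * (1 - (cmod z)\<^sup>2)) /
               (1 - (\<alpha> * (1 + \<beta>) * cmod (w z))\<^sup>2))) \<le> 1"
          unfolding k_def[symmetric] y_def[symmetric] W_def[symmetric] split[symmetric]
          by (rule order_trans[OF add_left_mono[OF weighted] total])
      qed (use \<alpha> \<beta> k59 in \<open>auto simp: k_def\<close>)
    qed
  qed
  have interior_case: "(\<lambda>z. H z + cnj (G z)) \<in> S_H"
    if \<beta>: "0 \<le> \<beta>" "\<beta> < 1" and small: "(1 + \<beta>) * p \<le> 1 - 3 / 2 * \<beta>" and \<alpha>: "0 \<le> \<alpha>"
      "\<alpha> \<le> 4 * (1 - \<beta>) / (4 * (2 * \<gamma> + 1) * (1 - \<beta>) + (\<beta> + (1 + \<beta>) * p)\<^sup>2 + 4 * (1 - \<beta>\<^sup>2) * h)"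
  proof -
    define D where "D = 2 * \<gamma> + 1 + (1 + \<beta>) * h"
    have "0 \<le> (1 + \<beta>) * h" using \<beta> h by simp
    then have D: "3 \<le> D" using assms(1) by (simp add: D_def)
    define N where "N = 4 * (2 * \<gamma> + 1) * (1 - \<beta>) + (\<beta> + (1 + \<beta>) * p)\<^sup>2 + 4 * (1 - \<beta>\<^sup>2) * h"
    have "4 * (1 - \<beta>) * D = 4 * (2 * \<gamma> + 1) * (1 - \<beta>) + 4 * (1 - \<beta>\<^sup>2) * h"
      by (simp add: D_def power2_eq_square algebra_simps)
    then have DN: "4 * (1 - \<beta>) * D \<le> N"
      unfolding N_def using zero_le_power2[of "\<beta> + (1 + \<beta>) * p"] by linarith
    have D0: "0 < 4 * (1 - \<beta>) * D" using \<beta> D by simp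
    have "\<alpha> \<le> 4 * (1 - \<beta>) / N" using \<alpha>(2) unfolding N_def .
    also have "\<dots> \<le> 4 * (1 - \<beta>) / (4 * (1 - \<beta>) * D)"
      using \<beta> by (intro divide_left_mono[OF DN] mult_pos_pos D0 less_le_trans[OF D0 DN]) auto
    also have "\<dots> = 1 / D" using \<beta> by simp
    finally have aD: "\<alpha> * D \<le> 1" using D by (simp add: field_simps)
    have "\<alpha> * 3 \<le> \<alpha> * D" using D \<alpha> by (intro mult_left_mono)
    then have "\<alpha> \<le> 1 / 3" using aD by simp
    moreover have "0 \<le> (1 + \<beta>) * p" using \<beta> p by simp
    then have "\<beta> \<le> 2 / 3" using small by simp
    ultimately have "k \<le> 1 / 3 * (5 / 3)" unfolding k_def using \<alpha> \<beta> by (intro mult_mono) auto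
    then have k: "k \<le> 5 / 9" by simp
    have u: "0 \<le> (1 + \<beta>) * h" "(1 + \<beta>) * h \<le> 1 - 3 / 2 * \<beta>"
    proof -
      have "(1 + \<beta>) * h \<le> (1 + \<beta>) * p" using p \<beta> by (intro mult_left_mono) auto
      then show "(1 + \<beta>) * h \<le> 1 - 3 / 2 * \<beta>" using small by simp
    qed (use \<beta> h in simp)
    show ?thesis
    proof (rule via_ratio[OF \<alpha>(1) \<beta>(1) k])
      fix r :: real assume r: "0 \<le> r" "r \<le> 1"
      have "\<alpha> * (\<gamma> * (1 + r) + (1 - r\<^sup>2) + \<beta> * r + r * (2 * ((1 + \<beta>) * h))) \<le> \<alpha> * D"
        using interior_budget[OF assms(1) \<beta>(1) u r] \<alpha> by (intro mult_left_mono) (auto simp: D_def)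
      then show "\<alpha> * (\<gamma> * (1 + r) + (1 - r\<^sup>2) + \<beta> * r) + r * (k * (2 * h)) \<le> 1"
        using aD by (simp add: k_def algebra_simps)
    qed
  qed
  have K: "(1 + \<beta>) * hyp_norm w * (1 + sup_norm w) = (1 + \<beta>) * p"
    "2 * (1 + \<beta>) * hyp_norm w * (1 + sup_norm w) = 2 * ((1 + \<beta>) * p)"
    by (simp_all add: p_def h_def m_def mult.assoc)
  show ?thesis
    unfolding K unfolding h_def[symmetric]
  proof (intro conjI impI)
    show "(\<lambda>z. H z + cnj (G z)) \<in> S_H"
      if "1 \<le> \<beta>" "0 \<le> \<alpha> \<and> \<alpha> \<le> 1 / (2 * \<gamma> + 2 * \<beta> + (1 + \<beta>) * p)"
      using that by (intro boundary_case) auto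
    show "(\<lambda>z. H z + cnj (G z)) \<in> S_H"
      if "0 \<le> \<beta> \<and> \<beta> < 1" "\<beta> + 2 * ((1 + \<beta>) * p) \<le> 2 * (1 - \<beta>)"
        "0 \<le> \<alpha> \<and> \<alpha> \<le> 4 * (1 - \<beta>) / (4 * (2 * \<gamma> + 1) * (1 - \<beta>) + (\<beta> + (1 + \<beta>) * p)\<^sup>2 + 4 * (1 - \<beta>\<^sup>2) * h)"
    proof (rule interior_case)
      show "(1 + \<beta>) * p \<le> 1 - 3 / 2 * \<beta>" using that(2) by argo
    qed (use that in blast)+
    show "(\<lambda>z. H z + cnj (G z)) \<in> S_H"
      if "0 \<le> \<beta> \<and> \<beta> < 1" "\<beta> + 2 * ((1 + \<beta>) * p) > 2 * (1 - \<beta>)"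
        "0 \<le> \<alpha> \<and> \<alpha> \<le> 1 / (2 * \<gamma> + 2 * \<beta> + (1 + \<beta>) * p)"
    proof (rule boundary_case)
      have "1 - 3 / 2 * \<beta> \<le> (1 + \<beta>) * p" using that(2) by argo
      then show "1 \<le> \<beta> \<or> 1 - 3 / 2 * \<beta> \<le> (1 + \<beta>) * p" ..
    qed (use that in blast)+
  qed
qed

end
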